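(* Let $N\ge1$, let $\mathcal T_1,\mathcal T_2,\mathcal T_3$, $U_i,U_o,Y,\mathcal Y$ and, depending on $\gamma$ (and $V\in\mathcal Y$), $Y_o,V_{co},V_{ci},Z,Z_{co},R,\hat R(V)$ be as in the context, and put $\hat{\mathcal T}_1(V)=\mathcal T_1-\mathcal T_2V\mathcal T_3$ and $\hat{\mathcal T}_2=z^{-N}\mathcal T_2$. Define $$\alpha:=\inf\{\|\hat{\mathcal T}_1(V)-\hat{\mathcal T}_2D\mathcal T_3\|_\infty : D\in\mathcal{RH}_\infty,\ V\in\mathcal{Y}\}.$$ Then: 1) $\alpha=\inf\{\gamma : \|Y\|_\infty<\gamma,\ \|Z\|_\infty<1, \text{ and there exists } V\in\mathcal{Y}\text{ with }\mathrm{dist}(\hat R(V),\mathcal{RH}_\infty)<1\}$; 2) for every $\gamma>\alpha$, every $V\in\mathcal Y$ and all $D,X\in\mathcal{RH}_\infty$ such that $\|\hat R(V)-X\|_\infty\le1$ and $X=Z_{co}^{-1}U_oDV_{co}$, one has $\|\hat{\mathcal T}_1(V)-\hat{\mathcal T}_2D\mathcal T_3\|_\infty\le\gamma$.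
   Context: Discrete time. $\mathcal{RL}_\infty$ is the set of real-rational transfer matrices (of whatever size is required) that are bounded on the unit circle, with norm $\|G\|_\infty=\sup_{|z|=1}\|G(z)\|$ (largest singular value). $\mathcal{RH}_\infty\subset\mathcal{RL}_\infty$ is the set of proper stable ones (all poles in $|z|<1$). $G^\sim(z):=G(z^{-1})^\top$. $\mathrm{dist}(R,\mathcal{RH}_\infty):=\inf\{\|R-X\|_\infty: X\in\mathcal{RH}_\infty\}$. Plant data: $A$ is a real matrix with spectral radius $<1$, and with real matrices $B_1,B_2,C_1,C_2,D_{12},D_{21}$, $\mathcal T_1=C_1(zI-A)^{-1}B_1$, $\mathcal T_2=C_1(zI-A)^{-1}B_2+D_{12}$ (with $p_2$ columns), $\mathcal T_3=C_2(zI-A)^{-1}B_1+D_{21}$ (with $q_2$ rows), where $D_{12}^\top D_{12}>0$, $D_{21}D_{21}^\top>0$, $C_1^\top D_{12}=0$, $B_1D_{21}^\top=0$. Definitions: - $\mathcal T_2=U_iU_o$ with $U_i,U_o,U_o^{-1}\in\mathcal{RH}_\infty$, $U_i^\sim U_i=I$. - $Y:=(I-U_iU_i^\sim)\mathcal T_1\in\mathcal{RL}_\infty$. - For $\gamma>\|Y\|_\infty$: $Y_o,Y_o^{-1}\in\mathcal{RH}_\infty$ with $Y_o^\sim Y_o=\gamma^2I-Y^\sim Y$. - $\mathcal T_3Y_o^{-1}=V_{co}V_{ci}$ with $V_{ci},V_{co},V_{co}^{-1}\in\mathcal{RH}_\infty$, $V_{ci}V_{ci}^\sim=I$ (co-inner-outer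 factorization). - $Z:=U_i^\sim\mathcal T_1Y_o^{-1}(I-V_{ci}^\sim V_{ci})\in\mathcal{RL}_\infty$. - If $\|Z\|_\infty<1$: $Z_{co},Z_{co}^{-1}\in\mathcal{RH}_\infty$ with $Z_{co}Z_{co}^\sim=I-ZZ^\sim$. - $R:=Z_{co}^{-1}U_i^\sim\mathcal T_1Y_o^{-1}V_{ci}^\sim\in\mathcal{RL}_\infty$. - $\mathcal{Y}=\bigoplus_{i=0}^{N-1}z^{-i}\mathcal{Y}_i$, i.e. the set of all $V=\sum_{i=0}^{N-1}z^{-i}V_i$ with $V_i\in\mathcal Y_i$, where each $\mathcal{Y}_i\subset\mathbb{R}^{p_2\times q_2}$ is a given linear subspace. - $\hat R(V):=z^NR-Z_{co}^{-1}U_o\,(z^NV)\,V_{co}$. Here $Y_o,V_{co},V_{ci},Z,Z_{co},R,\hat R(V)$ all depend on $\gamma$. *)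

theory Defs
  imports
    "HOL-Analysis.Analysis"
    "HOL-Computational_Algebra.Polynomial_Factorial"
    "HOL-Computational_Algebra.Field_as_Ring"
begin

section \<open>Matrix notions\<close>

definition pos_def_mat :: "real^'n^'n \<Rightarrow> bool" where
  "pos_def_mat M \<longleftrightarrow> transpose M = M \<and> (\<forall>x. x \<noteq> 0 \<longrightarrow> 0 < x \<bullet> (M *v x))"

definition eigenvalues :: "complex^'n^'n \<Rightarrow> complex set" where
  "eigenvalues M = {l. \<exists>v. v \<noteq> 0 \<and> M *v v = l *s v}"

definition spectral_radius :: "real^'n^'n \<Rightarrow> real" where
  "spectral_radius A = Max (cmod ` eigenvalues (map_matrix complex_of_real A))"

definition adjoint_mat :: "complex^'n^'m \<Rightarrow> complex^'m^'n" where
  "adjoint_mat M = map_matrix cnj (transpose M)"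

text \<open>Square roots of the eigenvalues of \<open>M\<^sup>* M\<close>. For a matrix with more columns than rows
  this set may contain an extra \<open>0\<close>, which does not affect its maximum.\<close>

definition singular_values :: "complex^'n^'m \<Rightarrow> real set" where
  "singular_values M =
     {s. 0 \<le> s \<and> complex_of_real (s\<^sup>2) \<in> eigenvalues (adjoint_mat M ** M)}"

definition max_singular_value :: "complex^'n^'m \<Rightarrow> real" where
  "max_singular_value M = Max (singular_values M)"


section \<open>Real-rational transfer matrices\<close>

text \<open>A scalar transfer function is a formal quotient of real polynomials in \<open>z\<close>, so products,
  inverses and equations between transfer matrices are those of matrices over the field
  \<open>\<real>(z)\<close>; \<open>('p, 'q) transfer\<close> has \<open>'p\<close> rows and \<open>'q\<close> columns.\<close>

type_synonym ratfun = "real poly fract"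
type_synonym ('p, 'q) transfer = "ratfun^'q^'p"

text \<open>Numerator and denominator in lowest terms (with monic denominator).\<close>

definition rat_num :: "ratfun \<Rightarrow> real poly" where
  "rat_num f = fst (quot_of_fract f)"

definition rat_den :: "ratfun \<Rightarrow> real poly" where
  "rat_den f = snd (quot_of_fract f)"

text \<open>Substitution of \<open>x\<close> for \<open>z\<close> in a field \<open>'a\<close> into which the reals are embedded by \<open>h\<close>.\<close>

definition rat_subst :: "(real \<Rightarrow> 'a::field) \<Rightarrow> 'a \<Rightarrow> ratfun \<Rightarrow> 'a" where
  "rat_subst h x f = poly (map_poly h (rat_num f)) x / poly (map_poly h (rat_den f)) x"

definition rat_const :: "real \<Rightarrow> ratfun" where
  "rat_const c = to_fract [:c:]"

definition rat_z :: ratfun where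
  "rat_z = to_fract [:0, 1:]"

definition const_tm :: "real^'q^'p \<Rightarrow> ('p::finite, 'q::finite) transfer" where
  "const_tm M = map_matrix rat_const M"

definition scale_tm :: "ratfun \<Rightarrow> ('p::finite, 'q::finite) transfer \<Rightarrow> ('p, 'q) transfer"
    (infixr "*\<^sub>t" 75) where
  "c *\<^sub>t G = map_matrix ((*) c) G"

text \<open>The value \<open>G(z)\<close> at a complex number; by the convention \<open>x / 0 = 0\<close>, an entry with a pole
  at \<open>z\<close> is given the value \<open>0\<close> there.\<close>

definition tm_eval :: "('p::finite, 'q::finite) transfer \<Rightarrow> complex \<Rightarrow> complex^'q^'p" where
  "tm_eval G z = map_matrix (rat_subst complex_of_real z) G"

text \<open>\<open>G\<^sup>\<sim>(z) = G(z\<^sup>-\<^sup>1)\<^sup>T\<close>\<close>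

definition para_conj :: "('p::finite, 'q::finite) transfer \<Rightarrow> ('q, 'p) transfer" where
  "para_conj G = transpose (map_matrix (rat_subst rat_const (inverse rat_z)) G)"

text \<open>The transfer matrix \<open>C(zI - A)\<^sup>-\<^sup>1B + D\<close>.\<close>

definition realization ::
    "real^'n^'n \<Rightarrow> real^'q^'n \<Rightarrow> real^'n^'p \<Rightarrow> real^'q^'p \<Rightarrow> ('p::finite, 'q::finite) transfer" where
  "realization A B C D =
     const_tm C ** matrix_inv (mat rat_z - const_tm A) ** const_tm B + const_tm D"


section \<open>The spaces \<open>RL\<^sub>\<infinity>\<close> and \<open>RH\<^sub>\<infinity>\<close>\<close>

text \<open>Near a pole on the unit circle a rational function is unbounded on the circle, so the
  value that \<open>tm_eval\<close> assigns at the pole itself is irrelevant for boundedness.\<close>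

definition RL_inf :: "('p::finite, 'q::finite) transfer set" where
  "RL_inf = {G. bounded (tm_eval G ` sphere 0 1)}"

text \<open>Meaningful for \<open>G \<in> RL_inf\<close>; otherwise the supremum is an unspecified real number.\<close>

definition hinf_norm :: "('p::finite, 'q::finite) transfer \<Rightarrow> real" where
  "hinf_norm G = (SUP z\<in>sphere 0 1. max_singular_value (tm_eval G z))"

definition rat_proper :: "ratfun \<Rightarrow> bool" where
  "rat_proper f \<longleftrightarrow> degree (rat_num f) \<le> degree (rat_den f)"

definition rat_poles :: "ratfun \<Rightarrow> complex set" where
  "rat_poles f = {z. poly (map_poly complex_of_real (rat_den f)) z = 0}"

definition RH_inf :: "('p::finite, 'q::finite) transfer set" where
  "RH_inf = {G. \<forall>i j. rat_proper (G $ i $ j) \<and> rat_poles (G $ i $ j) \<subseteq> ball 0 1}"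

definition RH_inf_units :: "('p::finite, 'p) transfer set" where
  "RH_inf_units = {G \<in> RH_inf. invertible G \<and> matrix_inv G \<in> RH_inf}"

definition dist_RH_inf :: "('p::finite, 'q::finite) transfer \<Rightarrow> real" where
  "dist_RH_inf R = (INF X\<in>RH_inf. hinf_norm (R - X))"


section \<open>Structured finite impulse responses\<close>

text \<open>\<open>\<Oplus>\<^sub>i z\<^sup>-\<^sup>i \<Y>\<^sub>i\<close> for \<open>i < N\<close>.\<close>

definition fir_space :: "nat \<Rightarrow> (nat \<Rightarrow> (real^'q^'p) set) \<Rightarrow> ('p::finite, 'q::finite) transfer set" where
  "fir_space N Ys =
     {\<Sum>i<N. (inverse rat_z ^ i) *\<^sub>t const_tm (V i) | V. \<forall>i<N. V i \<in> Ys i}"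

end

theory Submission
  imports Defs
begin

text \<open>
  Put \<open>Q = V + z\<^sup>-\<^sup>N D\<close>. The error to be minimised is then \<open>M = T\<^sub>1 - T\<^sub>2 Q T\<^sub>3\<close>, and the theorem
  follows from one equivalence: for \<open>\<parallel>Y\<parallel> < \<gamma>\<close> and \<open>\<parallel>Z\<parallel> < 1\<close>,

  \<open>\<parallel>M\<parallel> \<le> \<gamma>\<close> holds if and only if \<open>\<parallel>R'(V) - X\<parallel> \<le> 1\<close>,

  where \<open>R'(V) = Rhat \<gamma> V\<close> and \<open>X = Z\<^sub>c\<^sub>o\<^sup>-\<^sup>1 U\<^sub>o D V\<^sub>c\<^sub>o\<close>,
  together with its strict forms: \<open>\<parallel>M\<parallel> < \<gamma>\<close> implies \<open>\<parallel>Y\<parallel> < \<gamma>\<close>, \<open>\<parallel>Z\<parallel> < 1\<close> and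
  \<open>\<parallel>R'(V) - X\<parallel> < 1\<close>. Since \<open>U\<^sub>o\<close>, \<open>V\<^sub>c\<^sub>o\<close> and \<open>Z\<^sub>c\<^sub>o\<close> are units,
  \<open>D \<mapsto> X\<close> is a bijection of the proper stable matrices. Hence every \<open>\<gamma> > \<alpha>\<close> is
  feasible and no \<open>\<gamma> < \<alpha>\<close> is, and the second claim is one direction of the equivalence.

  The equivalence consists of two completions of squares on the unit circle. First, the inner factor
  splits the error orthogonally, \<open>M\<^sup>\<sim> M = Y\<^sup>\<sim> Y + W\<^sup>\<sim> W\<close> with \<open>W = U\<^sub>i\<^sup>\<sim> T\<^sub>1 - U\<^sub>o Q T\<^sub>3\<close>, so
  \<open>M\<^sup>\<sim> M \<le> \<gamma>\<^sup>2\<close> means \<open>W\<^sup>\<sim> W \<le> Y\<^sub>o\<^sup>\<sim> Y\<^sub>o\<close>, that is, \<open>S = W Y\<^sub>o\<^sup>-\<^sup>1\<close> is a contraction. Secondly,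
  \<open>S = U\<^sub>i\<^sup>\<sim> T\<^sub>1 Y\<^sub>o\<^sup>-\<^sup>1 - U\<^sub>o Q V\<^sub>c\<^sub>o V\<^sub>c\<^sub>i\<close> splits along the co-inner factor,
  \<open>S S\<^sup>\<sim> = Z Z\<^sup>\<sim> + P P\<^sup>\<sim>\<close> with
  \<open>P = U\<^sub>i\<^sup>\<sim> T\<^sub>1 Y\<^sub>o\<^sup>-\<^sup>1 V\<^sub>c\<^sub>i\<^sup>\<sim> - U\<^sub>o Q V\<^sub>c\<^sub>o\<close>, so \<open>S\<close> is a contraction if and only if \<open>Z\<^sub>c\<^sub>o\<^sup>-\<^sup>1 P\<close> is one; and
  \<open>z\<^sup>N Z\<^sub>c\<^sub>o\<^sup>-\<^sup>1 P = R'(V) - X\<close>, where \<open>z\<^sup>N\<close> has modulus one. The two steps are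
  \<open>isometry_reduction\<close> and its conjugate \<open>co_isometry_reduction\<close>; both rest on
  \<open>spectral_factor_contraction\<close>.

  To argue pointwise, the largest singular value is identified with the operator norm, and evaluation
  at points of the circle is shown to be a ring homomorphism on the rational matrices without poles
  there, which turns \<open>G\<^sup>\<sim>\<close> into the adjoint matrix.
\<close>

section \<open>The largest singular value as an operator norm\<close>

lemma inner_adjoint_mat:
  fixes M :: "complex^'n^'m"
  shows "(M *v x) \<bullet> y = x \<bullet> (adjoint_mat M *v y)"
proof -
  have "(M *v x) \<bullet> y = (\<Sum>i\<in>UNIV. \<Sum>j\<in>UNIV. (M $ i $ j * x $ j) \<bullet> (y $ i))"
    by (simp add: inner_vec_def matrix_vector_mult_def inner_sum_left)
  also have "\<dots> = (\<Sum>j\<in>UNIV. \<Sum>i\<in>UNIV. (M $ i $ j * x $ j) \<bullet> (y $ i))"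
    by (rule sum.swap)
  also have "\<dots> = (\<Sum>j\<in>UNIV. \<Sum>i\<in>UNIV. (x $ j) \<bullet> (cnj (M $ i $ j) * y $ i))"
    by (intro sum.cong refl) (simp add: inner_complex_def algebra_simps)
  also have "\<dots> = x \<bullet> (adjoint_mat M *v y)"
    by (simp add: inner_vec_def matrix_vector_mult_def inner_sum_right adjoint_mat_def transpose_def)
  finally show ?thesis .
qed

lemma norm_matrix_vector_sq:
  fixes M :: "complex^'n^'m"
  shows "(norm (M *v x))\<^sup>2 = x \<bullet> ((adjoint_mat M ** M) *v x)"
  by (simp add: power2_norm_eq_inner inner_adjoint_mat matrix_vector_mul_assoc)

lemma norm_matrix_vector_le:
  fixes M :: "complex^'n^'m"
  shows "norm (M *v x) \<le> norm M * norm x"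
proof -
  have "norm ((M *v x) $ i) \<le> norm (M $ i) * norm x" for i
  proof -
    have "norm ((M *v x) $ i) \<le> (\<Sum>j\<in>UNIV. \<bar>norm (M $ i $ j)\<bar> * \<bar>norm (x $ j)\<bar>)"
      unfolding matrix_vector_mult_def by (simp add: sum_norm_le norm_mult)
    also have "\<dots> \<le> norm (M $ i) * norm x"
      unfolding norm_vec_def by (rule L2_set_mult_ineq)
    finally show ?thesis .
  qed
  hence "norm (M *v x) \<le> L2_set (\<lambda>i. norm (M $ i) * norm x) UNIV"
    unfolding norm_vec_def[of "M *v x"] by (intro L2_set_mono) auto
  also have "\<dots> = norm M * norm x"
    by (simp add: norm_vec_def[of M] L2_set_left_distrib)
  finally show ?thesis .
qed

lemma mat_mult_vec: "mat c *v v = c *s v"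
  by (simp add: vec_eq_iff matrix_vector_mult_def mat_def if_distrib[of "\<lambda>x. x * _"] cong: if_cong)

lemma of_real_smult: "complex_of_real c *s v = c *\<^sub>R v"
  by (simp add: vec_eq_iff scaleR_conv_of_real[where 'a = complex])

lemma eigenvalues_iff_det: "l \<in> eigenvalues M \<longleftrightarrow> det (mat l - M) = 0"
proof -
  have "(mat l - M) *v v = l *s v - M *v v" for v
    by (simp add: matrix_vector_mult_diff_rdistrib mat_mult_vec)
  hence "l \<in> eigenvalues M \<longleftrightarrow> (\<exists>v. v \<noteq> 0 \<and> (mat l - M) *v v = 0)"
    unfolding eigenvalues_def by auto
  also have "\<dots> \<longleftrightarrow> \<not> invertible (mat l - M)"
    using matrix_left_invertible_ker[of "mat l - M"]
    by (auto simp: invertible_left_inverse)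
  finally show ?thesis by (simp add: invertible_det_nz)
qed

lemma poly_det: "poly (det P) l = det (map_matrix (\<lambda>p. poly p l) P)"
  for P :: "complex poly^'n^'n"
  by (simp add: det_def poly_sum poly_prod)

text \<open>The eigenvalues are the roots of the characteristic polynomial. That polynomial is not zero,
  because no number larger than the Frobenius norm can be an eigenvalue. Finiteness makes the maxima
  in the definitions of the spectral radius and of the largest singular value genuine upper bounds.\<close>

lemma finite_eigenvalues: "finite (eigenvalues M)"
  for M :: "complex^'n^'n"
proof -
  define P :: "complex poly^'n^'n" where "P = mat [:0, 1:] - map_matrix (\<lambda>c. [:c:]) M"
  have ev: "poly (det P) l = det (mat l - M)" for l
  proof -
    have "map_matrix (\<lambda>p. poly p l) P = mat l - M"
      by (simp add: P_def vec_eq_iff mat_def)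
    thus ?thesis by (simp add: poly_det)
  qed
  have "det P \<noteq> 0"
  proof
    assume "det P = 0"
    define l where "l = complex_of_real (norm M + 1)"
    from \<open>det P = 0\<close> ev[of l] have "l \<in> eigenvalues M" by (simp add: eigenvalues_iff_det)
    then obtain v where v: "v \<noteq> 0" "M *v v = l *s v" by (auto simp: eigenvalues_def)
    from v(2) norm_matrix_vector_le[of M v] have "(norm M + 1) * norm v \<le> norm M * norm v"
      by (simp add: l_def of_real_smult del: of_real_add)
    with v(1) show False by (simp add: algebra_simps)
  qed
  hence "finite {l. poly (det P) l = 0}" by (rule poly_roots_finite)
  moreover have "eigenvalues M = {l. poly (det P) l = 0}"
    by (auto simp: eigenvalues_iff_det ev)
  ultimately show ?thesis by simp
qed

lemma complex_matrix_vector_scaleR: "M *v (t *\<^sub>R x) = t *\<^sub>R (M *v x)"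
  for M :: "complex^'n^'m"
  by (rule linear_scale[OF matrix_vector_mul_linear])

text \<open>The form \<open>c\<^sup>2 \<parallel>x\<parallel>\<^sup>2 - \<parallel>M x\<parallel>\<^sup>2\<close> is nonnegative and vanishes at \<open>v\<close>. A self-adjoint operator
  whose quadratic form is nonnegative annihilates every zero of the form: otherwise a small step
  from \<open>v\<close> against its image would make the form negative.\<close>

lemma maximiser_is_eigenvector:
  fixes M :: "complex^'n^'m"
  assumes max: "\<And>x. norm (M *v x) \<le> c * norm x"
    and att: "norm (M *v v) = c * norm v"
  shows "(adjoint_mat M ** M) *v v = c\<^sup>2 *\<^sub>R v"
proof -
  define H where "H x = c\<^sup>2 *\<^sub>R x - (adjoint_mat M ** M) *v x" for x
  have lin: "H (x - t *\<^sub>R y) = H x - t *\<^sub>R H y" for x y t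
    by (simp add: H_def matrix_vector_mult_diff_distrib complex_matrix_vector_scaleR algebra_simps)
  have sym: "H x \<bullet> y = x \<bullet> H y" for x y
  proof -
    have "((adjoint_mat M ** M) *v x) \<bullet> y = x \<bullet> ((adjoint_mat M ** M) *v y)"
      by (metis inner_adjoint_mat inner_commute matrix_vector_mul_assoc)
    thus ?thesis by (simp add: H_def inner_diff_left inner_diff_right)
  qed
  have quad: "x \<bullet> H x = (c * norm x)\<^sup>2 - (norm (M *v x))\<^sup>2" for x
    by (simp add: H_def inner_diff_right norm_matrix_vector_sq power_mult_distrib
        power2_norm_eq_inner[of x])
  have pos: "x \<bullet> H x \<ge> 0" for x
    unfolding quad by (simp add: max power_mono)
  define w where "w = H v"
  define a where "a = w \<bullet> w"
  define b where "b = w \<bullet> H w"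
  have b: "b \<ge> 0" by (simp add: b_def pos)
  \<comment> \<open>the length of the step for which the linear decrease beats the quadratic term\<close>
  define t where "t = a / (b + 1)"
  have "0 \<le> (v - t *\<^sub>R w) \<bullet> H (v - t *\<^sub>R w)" by (rule pos)
  also have "\<dots> = v \<bullet> H v - 2 * t * (w \<bullet> H v) + t\<^sup>2 * (w \<bullet> H w)"
    using sym[of v w]
    by (simp add: lin inner_diff_left inner_diff_right power2_eq_square w_def inner_commute algebra_simps)
  also have "v \<bullet> H v = 0" unfolding quad by (simp add: att)
  finally have "2 * t * a \<le> t\<^sup>2 * b" by (simp add: a_def b_def w_def)
  hence "2 * a\<^sup>2 * (b + 1) \<le> a\<^sup>2 * b"
    using b by (simp add: t_def power2_eq_square divide_simps)
  hence "a\<^sup>2 * (b + 2) \<le> 0" by (simp add: algebra_simps)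
  hence "a = 0" using b by (auto simp: mult_le_0_iff)
  hence "w = 0" by (simp add: a_def)
  thus ?thesis by (simp add: w_def H_def)
qed

text \<open>The norm of \<open>M x\<close> attains its maximum \<open>c\<close> over the compact unit sphere, at an eigenvector
  of \<open>M\<^sup>* M\<close> for \<open>c\<^sup>2\<close>; hence \<open>c\<close> is a singular value. No singular value exceeds \<open>c\<close>, as
  an eigenvector for \<open>s\<^sup>2\<close> is stretched by exactly \<open>s\<close>.\<close>

lemma max_singular_value_operator_norm:
  fixes M :: "complex^'n^'m"
  shows "\<exists>v. norm v = 1 \<and> norm (M *v v) = max_singular_value M"
    and "norm (M *v x) \<le> max_singular_value M * norm x"
proof -
  have "continuous_on (sphere 0 1) (\<lambda>x. norm (M *v x))"
    by (intro continuous_intros linear_continuous_on linear_conv_bounded_linear[THEN iffD1]) simp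
  moreover have "norm (axis undefined 1 :: complex^'n) = 1" by simp
  hence "sphere 0 1 \<noteq> ({} :: (complex^'n) set)" by (metis empty_iff mem_sphere_0)
  ultimately obtain v where v: "norm v = 1" "\<And>x. norm x = 1 \<Longrightarrow> norm (M *v x) \<le> norm (M *v v)"
    using continuous_attains_sup[of "sphere 0 1" "\<lambda>x. norm (M *v x)"] by auto
  define c where "c = norm (M *v v)"
  have bound: "norm (M *v x) \<le> c * norm x" for x
  proof (cases "x = 0")
    case False
    with v(2)[of "x /\<^sub>R norm x"] show ?thesis
      by (simp add: complex_matrix_vector_scaleR c_def divide_simps mult.commute)
  qed auto
  have ev: "(adjoint_mat M ** M) *v v = c\<^sup>2 *\<^sub>R v"
    by (rule maximiser_is_eigenvector) (auto simp: bound v(1), simp add: c_def)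
  have "c \<in> singular_values M"
    unfolding singular_values_def eigenvalues_def
    using ev v(1) by (auto simp: c_def of_real_smult simp del: of_real_power intro!: exI[of _ v])
  moreover have "s \<le> c" if "s \<in> singular_values M" for s
  proof -
    from that obtain y where s: "s \<ge> 0" and y: "y \<noteq> 0"
      "(adjoint_mat M ** M) *v y = complex_of_real (s\<^sup>2) *s y"
      by (auto simp: singular_values_def eigenvalues_def)
    from y(2) have "(norm (M *v y))\<^sup>2 = (s * norm y)\<^sup>2"
      by (simp add: norm_matrix_vector_sq of_real_smult power_mult_distrib power2_norm_eq_inner[of y]
          del: of_real_power)
    hence "norm (M *v y) = s * norm y" using s by (simp add: power2_eq_iff_nonneg)
    with bound[of y] y(1) show "s \<le> c" by simp
  qed
  moreover have "finite (singular_values M)"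
  proof -
    have "inj_on (\<lambda>s. complex_of_real (s\<^sup>2)) {0..}"
      by (auto simp: inj_on_def of_real_eq_iff power2_eq_iff_nonneg simp del: of_real_power)
    hence "finite ((\<lambda>s. complex_of_real (s\<^sup>2)) -` eigenvalues (adjoint_mat M ** M) \<inter> {0..})"
      by (intro finite_vimage_IntI finite_eigenvalues)
    thus ?thesis by (rule finite_subset[rotated]) (auto simp: singular_values_def)
  qed
  ultimately have "max_singular_value M = c"
    unfolding max_singular_value_def by (intro Max_eqI) auto
  with bound v(1) show "\<exists>v. norm v = 1 \<and> norm (M *v v) = max_singular_value M"
    and "norm (M *v x) \<le> max_singular_value M * norm x"
    by (auto simp: c_def)
qed

lemma max_singular_value_le_iff:
  fixes M :: "complex^'n^'m"
  shows "max_singular_value M \<le> c \<longleftrightarrow> (\<forall>x. norm (M *v x) \<le> c * norm x)"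
proof
  assume "max_singular_value M \<le> c"
  thus "\<forall>x. norm (M *v x) \<le> c * norm x"
    by (meson max_singular_value_operator_norm(2) mult_right_mono norm_ge_zero order_trans)
next
  assume "\<forall>x. norm (M *v x) \<le> c * norm x"
  with max_singular_value_operator_norm(1)[of M] show "max_singular_value M \<le> c"
    by (metis mult.right_neutral)
qed

lemma adjoint_mat_bound:
  fixes M :: "complex^'n^'m"
  assumes "\<And>x. norm (M *v x) \<le> c * norm x"
  shows "norm (adjoint_mat M *v y) \<le> c * norm y"
proof (cases "adjoint_mat M *v y = 0")
  case True
  have "0 \<le> c" using assms[of "axis undefined 1"] by (simp add: order_trans[OF norm_ge_zero])
  with True show ?thesis by simp
next
  case False
  let ?u = "adjoint_mat M *v y"
  have "norm ?u * norm ?u = (M *v ?u) \<bullet> y"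
    by (simp add: inner_adjoint_mat power2_eq_square[symmetric] power2_norm_eq_inner)
  also have "\<dots> \<le> norm (M *v ?u) * norm y" by (rule norm_cauchy_schwarz)
  also have "\<dots> \<le> (c * norm ?u) * norm y" by (intro mult_right_mono assms) auto
  finally show ?thesis using False by (simp add: mult.commute mult.left_commute)
qed

section \<open>Substitution into rational functions\<close>

text \<open>Two substitutions have to be treated alike: complex numbers for \<open>z\<close>, which evaluates a transfer
  function, and \<open>z\<^sup>-\<^sup>1\<close> for \<open>z\<close>, which takes place inside the field \<open>\<real>(z)\<close> itself. Both are governed
  by a ring homomorphism from the reals into the target field.\<close>

definition real_hom :: "(real \<Rightarrow> 'a::field) \<Rightarrow> bool" where
  "real_hom h \<longleftrightarrow> h 0 = 0 \<and> h 1 = 1 \<and>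
     (\<forall>a b. h (a + b) = h a + h b) \<and> (\<forall>a b. h (a * b) = h a * h b)"

text \<open>Reading off regularity from the denominator in lowest terms makes it a property of the rational
  function; every representation whose denominator survives the substitution witnesses it.\<close>

definition regular :: "(real \<Rightarrow> 'a::field) \<Rightarrow> 'a \<Rightarrow> ratfun \<Rightarrow> bool" where
  "regular h x f \<longleftrightarrow> poly (map_poly h (rat_den f)) x \<noteq> 0"

lemma real_hom_of_real: "real_hom complex_of_real"
  by (simp add: real_hom_def)

lemma real_hom_rat_const: "real_hom rat_const"
proof -
  have "rat_const (a + b) = rat_const a + rat_const b" for a b
    by (simp add: rat_const_def flip: to_fract_add)
  moreover have "rat_const (a * b) = rat_const a * rat_const b" for a b
    by (simp add: rat_const_def flip: to_fract_mult)
  moreover have "rat_const 1 = 1" by (simp add: rat_const_def flip: one_pCons)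
  moreover have "rat_const 0 = 0" by (simp add: rat_const_def)
  ultimately show ?thesis by (simp add: real_hom_def)
qed

lemma rat_z_nonzero: "rat_z \<noteq> 0"
  by (simp add: rat_z_def)

lemma to_fract_pCons: "to_fract (pCons a p) = rat_const a + rat_z * to_fract p"
  by (simp add: rat_const_def rat_z_def flip: to_fract_add to_fract_mult)

lemma rat_den_nonzero: "rat_den f \<noteq> 0"
  by (simp add: rat_den_def)

lemma rat_num_over_den: "to_fract (rat_num f) / to_fract (rat_den f) = f"
  by (simp add: rat_num_def rat_den_def flip: Fract_conv_to_fract)

lemma fraction_lowest_terms:
  assumes "f = to_fract a / to_fract b" "b \<noteq> 0"
  obtains k where "a = rat_num f * k" "b = rat_den f * k"
proof -
  have "to_fract (a * rat_den f) = to_fract (rat_num f * b)"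
    using assms rat_num_over_den[of f] rat_den_nonzero[of f]
    by (simp add: divide_simps mult.commute)
  hence eq: "a * rat_den f = rat_num f * b" by (simp only: to_fract_eq_iff)
  moreover have "coprime (rat_num f) (rat_den f)"
    by (simp add: rat_num_def rat_den_def coprime_quot_of_fract)
  ultimately have "rat_den f dvd b"
    by (metis coprime_commute coprime_dvd_mult_right_iff dvd_triv_right)
  then obtain k where k: "b = rat_den f * k" by (rule dvdE)
  with eq have "a = rat_num f * k" using rat_den_nonzero[of f] by (simp add: mult.left_commute)
  with k show ?thesis using that by blast
qed

context
  fixes h :: "real \<Rightarrow> 'a::field" and x :: 'a
  assumes h: "real_hom h"
begin

lemma poly_hom_pCons: "poly (map_poly h (pCons a p)) x = h a + x * poly (map_poly h p) x"
  using h by (simp add: real_hom_def map_poly_pCons)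

lemma poly_hom_add:
  "poly (map_poly h (p + q)) x = poly (map_poly h p) x + poly (map_poly h q) x"
  using h by (induction p q rule: poly_induct2)
    (simp_all add: poly_hom_pCons real_hom_def algebra_simps)

lemma poly_hom_smult: "poly (map_poly h (smult a p)) x = h a * poly (map_poly h p) x"
  using h by (induction p) (simp_all add: poly_hom_pCons real_hom_def algebra_simps)

lemma poly_hom_mult:
  "poly (map_poly h (p * q)) x = poly (map_poly h p) x * poly (map_poly h q) x"
  using h
  by (induction p) (simp_all add: poly_hom_pCons poly_hom_smult poly_hom_add real_hom_def algebra_simps)

text \<open>The reduced fraction arises by cancelling a common factor \<open>k\<close>. Since the given denominator
  is not zero at \<open>x\<close>, neither are its two factors, so \<open>k\<close> may also be cancelled after the
  substitution. This is what makes substitution multiplicative and additive where there is no pole.\<close>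

lemma regular_fraction:
  assumes "poly (map_poly h b) x \<noteq> 0"
  shows "regular h x (to_fract a / to_fract b)"
    and "rat_subst h x (to_fract a / to_fract b) = poly (map_poly h a) x / poly (map_poly h b) x"
proof -
  let ?f = "to_fract a / to_fract b"
  from assms have "b \<noteq> 0" by auto
  then obtain k where k: "a = rat_num ?f * k" "b = rat_den ?f * k"
    using fraction_lowest_terms[OF refl] by metis
  let ?e = "\<lambda>p. poly (map_poly h p) x"
  have e: "?e a = ?e (rat_num ?f) * ?e k" "?e b = ?e (rat_den ?f) * ?e k"
    using arg_cong[OF k(1), of ?e] arg_cong[OF k(2), of ?e] by (simp_all only: poly_hom_mult)
  from e(2) assms have nz: "?e (rat_den ?f) \<noteq> 0" "?e k \<noteq> 0" by auto
  thus "regular h x ?f" by (simp add: regular_def)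
  from nz show "rat_subst h x ?f = ?e a / ?e b" unfolding e by (simp add: rat_subst_def)
qed

lemma regular_to_fract:
  "regular h x (to_fract a)" "rat_subst h x (to_fract a) = poly (map_poly h a) x"
  using regular_fraction[of 1 a] h by (simp_all add: real_hom_def)

lemma regular_const: "regular h x (rat_const c)" "rat_subst h x (rat_const c) = h c"
  unfolding rat_const_def by (simp_all add: regular_to_fract poly_hom_pCons)

lemma regular_z: "regular h x rat_z" "rat_subst h x rat_z = x"
  using h unfolding rat_z_def by (simp_all add: regular_to_fract poly_hom_pCons real_hom_def)

lemma regular_add:
  assumes "regular h x f" "regular h x g"
  shows "regular h x (f + g)" "rat_subst h x (f + g) = rat_subst h x f + rat_subst h x g"
proof -
  let ?e = "\<lambda>p. poly (map_poly h p) x"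
  have nz: "?e (rat_den f * rat_den g) \<noteq> 0" using assms by (simp add: poly_hom_mult regular_def)
  have "to_fract (rat_num f) / to_fract (rat_den f) + to_fract (rat_num g) / to_fract (rat_den g) =
      to_fract (rat_num f * rat_den g + rat_num g * rat_den f) / to_fract (rat_den f * rat_den g)"
    by (simp add: rat_den_nonzero add_frac_eq)
  hence eq: "f + g = to_fract (rat_num f * rat_den g + rat_num g * rat_den f) /
      to_fract (rat_den f * rat_den g)"
    by (simp only: rat_num_over_den)
  show "regular h x (f + g)" unfolding eq by (rule regular_fraction(1)[OF nz])
  have "rat_subst h x (f + g) = ?e (rat_num f * rat_den g + rat_num g * rat_den f) /
      ?e (rat_den f * rat_den g)"
    unfolding eq by (rule regular_fraction(2)[OF nz])
  also have "\<dots> = rat_subst h x f + rat_subst h x g"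
    using assms by (simp add: rat_subst_def regular_def poly_hom_mult poly_hom_add add_frac_eq)
  finally show "rat_subst h x (f + g) = rat_subst h x f + rat_subst h x g" .
qed

lemma regular_mult:
  assumes "regular h x f" "regular h x g"
  shows "regular h x (f * g)" "rat_subst h x (f * g) = rat_subst h x f * rat_subst h x g"
proof -
  let ?e = "\<lambda>p. poly (map_poly h p) x"
  have nz: "?e (rat_den f * rat_den g) \<noteq> 0" using assms by (simp add: poly_hom_mult regular_def)
  have "to_fract (rat_num f) / to_fract (rat_den f) * (to_fract (rat_num g) / to_fract (rat_den g)) =
      to_fract (rat_num f * rat_num g) / to_fract (rat_den f * rat_den g)"
    by simp
  hence eq: "f * g = to_fract (rat_num f * rat_num g) / to_fract (rat_den f * rat_den g)"
    by (simp only: rat_num_over_den)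
  show "regular h x (f * g)" unfolding eq by (rule regular_fraction(1)[OF nz])
  have "rat_subst h x (f * g) = ?e (rat_num f * rat_num g) / ?e (rat_den f * rat_den g)"
    unfolding eq by (rule regular_fraction(2)[OF nz])
  thus "rat_subst h x (f * g) = rat_subst h x f * rat_subst h x g"
    by (simp add: rat_subst_def poly_hom_mult)
qed

lemma regular_inverse:
  assumes "regular h x f" "rat_subst h x f \<noteq> 0"
  shows "regular h x (inverse f)" "rat_subst h x (inverse f) = inverse (rat_subst h x f)"
proof -
  have eq: "inverse f = to_fract (rat_den f) / to_fract (rat_num f)"
    using arg_cong[OF rat_num_over_den[of f], of inverse] by simp
  have nz: "poly (map_poly h (rat_num f)) x \<noteq> 0" using assms by (auto simp: rat_subst_def)
  show "regular h x (inverse f)" unfolding eq by (rule regular_fraction(1)[OF nz])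
  have "rat_subst h x (inverse f) = poly (map_poly h (rat_den f)) x / poly (map_poly h (rat_num f)) x"
    unfolding eq by (rule regular_fraction(2)[OF nz])
  thus "rat_subst h x (inverse f) = inverse (rat_subst h x f)"
    by (simp add: rat_subst_def)
qed

lemma regular_divide:
  assumes "regular h x f" "regular h x g" "rat_subst h x g \<noteq> 0"
  shows "regular h x (f / g)" "rat_subst h x (f / g) = rat_subst h x f / rat_subst h x g"
  using assms by (simp_all add: divide_inverse regular_mult regular_inverse)

lemma regular_0: "regular h x 0" "rat_subst h x 0 = 0"
  using regular_to_fract[of 0] h by (simp_all add: real_hom_def)

lemma regular_1: "regular h x 1" "rat_subst h x 1 = 1"
  using regular_to_fract[of 1] h by (simp_all add: real_hom_def)

lemma regular_uminus:
  assumes "regular h x f"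
  shows "regular h x (- f)" "rat_subst h x (- f) = - rat_subst h x f"
proof -
  have m: "rat_const (-1) = -1"
    by (simp add: rat_const_def one_pCons flip: to_fract_1 to_fract_uminus)
  have "h (-1) + h 1 = h 0" using h by (metis real_hom_def add.left_inverse)
  hence "h (-1) = -1" using h by (simp add: real_hom_def eq_neg_iff_add_eq_0)
  with regular_const[of "-1"] regular_mult[OF _ assms, of "-1"]
  show "regular h x (- f)" "rat_subst h x (- f) = - rat_subst h x f"
    by (simp_all add: m)
qed

lemma regular_diff:
  assumes "regular h x f" "regular h x g"
  shows "regular h x (f - g)" "rat_subst h x (f - g) = rat_subst h x f - rat_subst h x g"
  using regular_add[OF assms(1) regular_uminus(1)[OF assms(2)]] regular_uminus(2)[OF assms(2)]
  by simp_all

lemma regular_sum: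
  assumes "\<And>i. i \<in> I \<Longrightarrow> regular h x (f i)"
  shows "regular h x (sum f I)" "rat_subst h x (sum f I) = (\<Sum>i\<in>I. rat_subst h x (f i))"
proof -
  have "regular h x (sum f I) \<and> rat_subst h x (sum f I) = (\<Sum>i\<in>I. rat_subst h x (f i))"
    using assms
    by (induction I rule: infinite_finite_induct) (auto simp: regular_0 regular_add)
  thus "regular h x (sum f I)" "rat_subst h x (sum f I) = (\<Sum>i\<in>I. rat_subst h x (f i))" by auto
qed

lemma regular_prod:
  assumes "\<And>i. i \<in> I \<Longrightarrow> regular h x (f i)"
  shows "regular h x (prod f I)" "rat_subst h x (prod f I) = (\<Prod>i\<in>I. rat_subst h x (f i))"
proof -
  have "regular h x (prod f I) \<and> rat_subst h x (prod f I) = (\<Prod>i\<in>I. rat_subst h x (f i))"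
    using assms
    by (induction I rule: infinite_finite_induct) (auto simp: regular_1 regular_mult)
  thus "regular h x (prod f I)" "rat_subst h x (prod f I) = (\<Prod>i\<in>I. rat_subst h x (f i))" by auto
qed

lemma regular_power:
  assumes "regular h x f"
  shows "regular h x (f ^ n)" "rat_subst h x (f ^ n) = rat_subst h x f ^ n"
  using regular_prod[of "{..<n}" "\<lambda>_. f"] assms by simp_all

lemma regular_poly_inverse_z:
  assumes "x \<noteq> 0"
  shows "regular h x (poly (map_poly rat_const p) (inverse rat_z))"
    and "rat_subst h x (poly (map_poly rat_const p) (inverse rat_z)) = poly (map_poly h p) (inverse x)"
proof -
  have iz: "regular h x (inverse rat_z)" "rat_subst h x (inverse rat_z) = inverse x"
    using assms by (simp_all add: regular_inverse regular_z)
  have "regular h x (poly (map_poly rat_const p) (inverse rat_z)) \<and>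
      rat_subst h x (poly (map_poly rat_const p) (inverse rat_z)) = poly (map_poly h p) (inverse x)"
  proof (induction p)
    case 0
    thus ?case by (simp add: regular_0)
  next
    case (pCons a p)
    have *: "map_poly rat_const (pCons a p) = pCons (rat_const a) (map_poly rat_const p)"
      "map_poly h (pCons a p) = pCons (h a) (map_poly h p)"
      using real_hom_rat_const h by (simp_all add: real_hom_def map_poly_pCons)
    show ?case using pCons.IH by (simp add: * regular_add regular_mult regular_const iz)
  qed
  thus "regular h x (poly (map_poly rat_const p) (inverse rat_z))"
    "rat_subst h x (poly (map_poly rat_const p) (inverse rat_z)) = poly (map_poly h p) (inverse x)"
    by auto
qed

end

text \<open>The element \<open>z\<^sup>-\<^sup>1\<close> is transcendental: otherwise every nonzero complex number would be a root.
  Consequently the substitution of \<open>z\<^sup>-\<^sup>1\<close> never meets a pole.\<close>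

lemma poly_rat_const_inverse_z_eq_0: 
  assumes "poly (map_poly rat_const p) (inverse rat_z) = 0"
  shows "p = 0"
proof (rule ccontr)
  assume "p \<noteq> 0"
  hence "map_poly complex_of_real p \<noteq> 0" by (simp add: map_poly_eq_0_iff)
  hence "finite {w. poly (map_poly complex_of_real p) w = 0}" by (rule poly_roots_finite)
  then obtain w where w: "w \<notin> insert 0 {w. poly (map_poly complex_of_real p) w = 0}"
    using ex_new_if_finite[OF infinite_UNIV_char_0] by (metis finite_insert)
  have "poly (map_poly complex_of_real p) w = 0"
    using regular_poly_inverse_z(2)[OF real_hom_of_real, of "inverse w" p] assms w
    by (simp add: regular_0[OF real_hom_of_real])
  with w show False by simp
qed

lemma regular_inverse_z: "regular rat_const (inverse rat_z) f"
  using poly_rat_const_inverse_z_eq_0 rat_den_nonzero by (auto simp: regular_def)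

text \<open>Following the substitution of \<open>z\<^sup>-\<^sup>1\<close> by that of \<open>x\<close> amounts to substituting
  \<open>x\<^sup>-\<^sup>1\<close>. With \<open>x\<close> on the unit circle this computes the values of \<open>G\<^sup>\<sim>\<close>; with
  \<open>x = z\<^sup>-\<^sup>1\<close> it shows that \<open>z \<mapsto> z\<^sup>-\<^sup>1\<close> is an involution.\<close>

lemma regular_reflect:
  assumes "real_hom h" "x \<noteq> 0" "regular h (inverse x) f"
  shows "regular h x (rat_subst rat_const (inverse rat_z) f)"
    and "rat_subst h x (rat_subst rat_const (inverse rat_z) f) = rat_subst h (inverse x) f"
  using assms regular_divide[OF assms(1) regular_poly_inverse_z(1)[OF assms(1,2)]
      regular_poly_inverse_z(1)[OF assms(1,2)]]
  by (simp_all add: rat_subst_def[of rat_const] regular_poly_inverse_z[OF assms(1,2)]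
      regular_def[of h "inverse x"] rat_subst_def[of h "inverse x" f])

lemma reflect_reflect: "rat_subst rat_const (inverse rat_z) (rat_subst rat_const (inverse rat_z) f) = f"
proof -
  have p: "poly (map_poly rat_const p) rat_z = to_fract p" for p
    by (induction p) (simp_all add: to_fract_pCons poly_hom_pCons[OF real_hom_rat_const])
  have "regular rat_const (inverse (inverse rat_z)) f"
    by (simp add: regular_def p rat_den_nonzero)
  hence "rat_subst rat_const (inverse rat_z) (rat_subst rat_const (inverse rat_z) f) =
      rat_subst rat_const rat_z f"
    using regular_reflect(2)[OF real_hom_rat_const, of "inverse rat_z" f] by (simp add: rat_z_nonzero)
  also have "\<dots> = f" by (simp add: rat_subst_def p rat_num_over_den)
  finally show ?thesis .
qed

lemma poly_of_real_cnj:
  "poly (map_poly complex_of_real p) (cnj z) = cnj (poly (map_poly complex_of_real p) z)"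
  by (induction p) (simp_all add: poly_hom_pCons[OF real_hom_of_real])

lemma rat_subst_cnj: 
  "rat_subst complex_of_real (cnj z) f = cnj (rat_subst complex_of_real z f)"
  "regular complex_of_real (cnj z) f = regular complex_of_real z f"
  by (simp_all add: rat_subst_def regular_def poly_of_real_cnj)

section \<open>Transfer matrices without poles on the unit circle\<close>

text \<open>All matrices of the problem are built by sums, products and conjugates from proper stable ones,
  constants, powers of \<open>z\<close> and stable realizations. Freedom from poles on the circle is inherited
  by all of these operations, and on this class evaluation is a ring homomorphism; it is therefore more
  convenient here than boundedness, which it implies.\<close>

definition circle_regular :: "('p::finite, 'q::finite) transfer \<Rightarrow> bool" where
  "circle_regular G \<longleftrightarrow> (\<forall>z\<in>sphere 0 1. \<forall>i j. regular complex_of_real z (G $ i $ j))"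

lemma circle_regularD:
  "circle_regular G \<Longrightarrow> cmod z = 1 \<Longrightarrow> regular complex_of_real z (G $ i $ j)"
  by (simp add: circle_regular_def)

lemmas regular_simps =
  regular_add[OF real_hom_of_real] regular_diff[OF real_hom_of_real]
  regular_mult[OF real_hom_of_real] regular_sum[OF real_hom_of_real]
  regular_const[OF real_hom_of_real] regular_0[OF real_hom_of_real] regular_1[OF real_hom_of_real]
  regular_prod[OF real_hom_of_real] regular_power[OF real_hom_of_real] regular_z[OF real_hom_of_real]
  regular_uminus[OF real_hom_of_real]

lemma circle_regular_add: "circle_regular G \<Longrightarrow> circle_regular H \<Longrightarrow> circle_regular (G + H)"
  and circle_regular_diff: "circle_regular G \<Longrightarrow> circle_regular H \<Longrightarrow> circle_regular (G - H)"
  and circle_regular_mat: "circle_regular (mat (rat_const c))"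
  and circle_regular_mat_1: "circle_regular (mat 1)"
  and circle_regular_0: "circle_regular 0"
  and circle_regular_const: "circle_regular (const_tm C)"
  by (simp_all add: circle_regular_def regular_simps mat_def const_tm_def)

lemma circle_regular_mult:
  "circle_regular G \<Longrightarrow> circle_regular H \<Longrightarrow> circle_regular (G ** H)"
  by (simp add: circle_regular_def regular_simps matrix_matrix_mult_def)

lemma circle_regular_sum:
  "(\<And>i. i \<in> I \<Longrightarrow> circle_regular (G i)) \<Longrightarrow> circle_regular (\<Sum>i\<in>I. G i)"
  by (induction I rule: infinite_finite_induct) (simp_all add: circle_regular_0 circle_regular_add)

lemma circle_regular_scale_z:
  "circle_regular G \<Longrightarrow> circle_regular (rat_z ^ n *\<^sub>t G)"
  "circle_regular G \<Longrightarrow> circle_regular (inverse rat_z ^ n *\<^sub>t G)"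
proof -
  assume G: "circle_regular G"
  thus "circle_regular (rat_z ^ n *\<^sub>t G)"
    by (simp add: circle_regular_def scale_tm_def regular_simps)
  have "regular complex_of_real z (inverse rat_z)" if "cmod z = 1" for z
    using that by (intro regular_inverse[OF real_hom_of_real]) (auto simp: regular_simps)
  with G show "circle_regular (inverse rat_z ^ n *\<^sub>t G)"
    by (simp add: circle_regular_def scale_tm_def regular_simps)
qed

lemma inverse_on_circle: "cmod z = 1 \<Longrightarrow> inverse z = cnj z"
  by (metis complex_div_cnj divide_complex_def mult_1 norm_one power_one complex_norm_square
      inverse_unique of_real_1)

lemma circle_regular_para_conj:
  assumes "circle_regular G"
  shows "circle_regular (para_conj G)"
proof -
  have "regular complex_of_real z (para_conj G $ i $ j)" if "cmod z = 1" for z i j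
    using regular_reflect(1)[OF real_hom_of_real, of z "G $ j $ i"] circle_regularD[OF assms that] that
    by (force simp: para_conj_def transpose_def inverse_on_circle rat_subst_cnj)
  thus ?thesis by (simp add: circle_regular_def)
qed

lemma tm_eval_add: "tm_eval (G + H) z = tm_eval G z + tm_eval H z"
  and tm_eval_diff: "tm_eval (G - H) z = tm_eval G z - tm_eval H z"
  if "circle_regular G" "circle_regular H" "cmod z = 1"
  using that by (simp_all add: tm_eval_def circle_regularD regular_simps vec_eq_iff)

lemma tm_eval_mult:
  "circle_regular G \<Longrightarrow> circle_regular H \<Longrightarrow> cmod z = 1 \<Longrightarrow>
    tm_eval (G ** H) z = tm_eval G z ** tm_eval H z"
  by (simp add: tm_eval_def circle_regularD regular_simps vec_eq_iff matrix_matrix_mult_def)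

lemma tm_eval_mat: "tm_eval (mat (rat_const c)) z = mat (complex_of_real c)"
  "tm_eval (mat 1) z = mat 1"
  by (simp_all add: tm_eval_def mat_def regular_simps vec_eq_iff)

lemma tm_eval_scale_z:
  "circle_regular G \<Longrightarrow> cmod z = 1 \<Longrightarrow>
    tm_eval (rat_z ^ n *\<^sub>t G) z = map_matrix ((*) (z ^ n)) (tm_eval G z)"
  by (simp add: tm_eval_def scale_tm_def vec_eq_iff regular_simps circle_regularD)

text \<open>On the unit circle \<open>z\<^sup>-\<^sup>1\<close> is the complex conjugate of \<open>z\<close>, and the coefficients are real.\<close>

lemma tm_eval_para_conj:
  assumes "circle_regular G" "cmod z = 1"
  shows "tm_eval (para_conj G) z = adjoint_mat (tm_eval G z)"
proof -
  have "rat_subst complex_of_real z (para_conj G $ i $ j) =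
      cnj (rat_subst complex_of_real z (G $ j $ i))" for i j
    using regular_reflect(2)[OF real_hom_of_real, of z "G $ j $ i"] circle_regularD[OF assms] assms(2)
    by (force simp: para_conj_def transpose_def inverse_on_circle rat_subst_cnj)
  thus ?thesis by (simp add: tm_eval_def adjoint_mat_def transpose_def vec_eq_iff)
qed

lemma circle_regular_bounded:
  assumes "circle_regular G"
  shows "bounded (tm_eval G ` sphere 0 1)"
proof -
  have "continuous_on (sphere 0 1) (\<lambda>z. rat_subst complex_of_real z (G $ i $ j))" for i j
    unfolding rat_subst_def using assms
    by (intro continuous_intros) (auto simp: circle_regular_def regular_def)
  hence "continuous_on (sphere 0 1) (tm_eval G)"
    unfolding tm_eval_def map_matrix_def by (intro continuous_on_vec_lambda)
  thus ?thesis by (intro compact_imp_bounded compact_continuous_image) auto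
qed

section \<open>The para-Hermitian conjugate\<close>

lemma para_conj_para_conj: "para_conj (para_conj G) = G"
  by (simp add: para_conj_def transpose_def vec_eq_iff reflect_reflect)

lemmas reflect_simps = regular_add[OF real_hom_rat_const] regular_diff[OF real_hom_rat_const]
   regular_mult[OF real_hom_rat_const] regular_sum[OF real_hom_rat_const] regular_inverse_z
   regular_1[OF real_hom_rat_const] regular_0[OF real_hom_rat_const]

lemma para_conj_add: "para_conj (G + H) = para_conj G + para_conj H"
  and para_conj_diff: "para_conj (G - H) = para_conj G - para_conj H"
  by (simp_all add: para_conj_def transpose_def vec_eq_iff reflect_simps)

lemma para_conj_mult: "para_conj (G ** H) = para_conj H ** para_conj G"
  by (simp add: para_conj_def transpose_def vec_eq_iff reflect_simps matrix_matrix_mult_def mult.commute)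

lemma para_conj_mat_1: "para_conj (mat 1) = mat 1"
  by (simp add: para_conj_def transpose_def mat_def vec_eq_iff reflect_simps)

section \<open>The supremum norm on the unit circle\<close>

text \<open>Continuity on the compact circle makes the supremum finite. From here on the norm is used only
  through this description.\<close>

lemma hinf_norm_le_iff:
  assumes "circle_regular G"
  shows "hinf_norm G \<le> c \<longleftrightarrow> (\<forall>z. cmod z = 1 \<longrightarrow> (\<forall>x. norm (tm_eval G z *v x) \<le> c * norm x))"
proof -
  from circle_regular_bounded[OF assms] obtain K where K: "\<And>z. cmod z = 1 \<Longrightarrow> norm (tm_eval G z) \<le> K"
    unfolding bounded_iff by (metis imageI mem_sphere_0)
  have "max_singular_value (tm_eval G z) \<le> K" if "cmod z = 1" for z
    unfolding max_singular_value_le_iff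
    using K[OF that] norm_matrix_vector_le by (meson mult_right_mono norm_ge_zero order_trans)
  hence bdd: "bdd_above ((\<lambda>z. max_singular_value (tm_eval G z)) ` sphere 0 1)"
    by (auto intro!: bdd_aboveI2[of _ _ K])
  have ne: "sphere (0::complex) 1 \<noteq> {}" using norm_one by fastforce
  have "hinf_norm G \<le> c \<longleftrightarrow> (\<forall>z\<in>sphere 0 1. max_singular_value (tm_eval G z) \<le> c)"
    unfolding hinf_norm_def by (rule cSUP_le_iff[OF ne bdd])
  thus ?thesis by (auto simp: max_singular_value_le_iff)
qed

lemma hinf_norm_bound:
  "circle_regular G \<Longrightarrow> cmod z = 1 \<Longrightarrow> norm (tm_eval G z *v x) \<le> hinf_norm G * norm x"
  using hinf_norm_le_iff[of G "hinf_norm G"] by auto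

lemma hinf_norm_nonneg: "circle_regular G \<Longrightarrow> 0 \<le> hinf_norm G"
  using hinf_norm_bound[of G 1 "axis undefined 1"] by (simp add: order_trans[OF norm_ge_zero])

lemma hinf_norm_para_conj_le:
  assumes "circle_regular G"
  shows "hinf_norm (para_conj G) \<le> hinf_norm G"
  using assms adjoint_mat_bound[OF hinf_norm_bound[OF assms]]
  by (simp add: hinf_norm_le_iff circle_regular_para_conj tm_eval_para_conj)

lemma hinf_norm_para_conj:
  assumes "circle_regular G"
  shows "hinf_norm (para_conj G) = hinf_norm G"
  using hinf_norm_para_conj_le[OF assms]
    hinf_norm_para_conj_le[OF circle_regular_para_conj[OF assms]]
  by (simp add: para_conj_para_conj)

text \<open>Multiplication by \<open>z\<^sup>n\<close> is an isometry at each point of the circle, although it destroys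
  properness. This is how the delay is moved off the free parameter.\<close>

lemma hinf_norm_scale_z:
  assumes "circle_regular G"
  shows "hinf_norm (rat_z ^ n *\<^sub>t G) = hinf_norm G"
proof -
  have "norm (tm_eval (rat_z ^ n *\<^sub>t G) z *v x) = norm (tm_eval G z *v x)" if "cmod z = 1" for z x
  proof -
    have "tm_eval (rat_z ^ n *\<^sub>t G) z *v x = z ^ n *s (tm_eval G z *v x)"
      by (simp add: tm_eval_scale_z assms that matrix_vector_mult_def vec_eq_iff sum_distrib_left mult.assoc)
    thus ?thesis using that by (simp add: norm_vec_def norm_mult norm_power)
  qed
  hence "hinf_norm (rat_z ^ n *\<^sub>t G) \<le> c \<longleftrightarrow> hinf_norm G \<le> c" for c
    by (simp add: hinf_norm_le_iff assms circle_regular_scale_z)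
  thus ?thesis by (meson order_antisym order_refl)
qed

section \<open>Proper stable transfer matrices\<close>

lemma rat_poles_subset_ball_iff:
  "rat_poles f \<subseteq> ball 0 1 \<longleftrightarrow> (\<forall>z. 1 \<le> cmod z \<longrightarrow> regular complex_of_real z f)"
  by (auto simp: rat_poles_def regular_def subset_eq not_le)

text \<open>Cancelling a common factor changes both degrees by the same amount.\<close>

lemma rat_properI:
  assumes "f = to_fract a / to_fract b" "b \<noteq> 0" "degree a \<le> degree b"
  shows "rat_proper f"
proof (cases "rat_num f = 0")
  case False
  from assms(1,2) obtain k where k: "a = rat_num f * k" "b = rat_den f * k"
    by (rule fraction_lowest_terms)
  with assms(2) have "k \<noteq> 0" by auto
  hence "degree a = degree (rat_num f) + degree k" "degree b = degree (rat_den f) + degree k"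
    unfolding k using False rat_den_nonzero by (auto simp: degree_mult_eq)
  with assms(3) show ?thesis by (simp add: rat_proper_def)
qed (simp add: rat_proper_def)

lemma rat_proper_add:
  assumes "rat_proper f" "rat_proper g"
  shows "rat_proper (f + g)"
proof (rule rat_properI)
  have "to_fract (rat_num f) / to_fract (rat_den f) + to_fract (rat_num g) / to_fract (rat_den g) =
      to_fract (rat_num f * rat_den g + rat_num g * rat_den f) / to_fract (rat_den f * rat_den g)"
    by (simp add: rat_den_nonzero add_frac_eq)
  thus "f + g = to_fract (rat_num f * rat_den g + rat_num g * rat_den f) /
      to_fract (rat_den f * rat_den g)"
    by (simp only: rat_num_over_den)
  show "degree (rat_num f * rat_den g + rat_num g * rat_den f) \<le> degree (rat_den f * rat_den g)"
    using assms rat_den_nonzero[of f] rat_den_nonzero[of g] unfolding rat_proper_def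
    by (intro degree_add_le order.trans[OF degree_mult_le]) (auto simp: degree_mult_eq)
qed (simp add: rat_den_nonzero)

lemma rat_proper_mult:
  assumes "rat_proper f" "rat_proper g"
  shows "rat_proper (f * g)"
proof (rule rat_properI)
  have "to_fract (rat_num f) / to_fract (rat_den f) * (to_fract (rat_num g) / to_fract (rat_den g)) =
      to_fract (rat_num f * rat_num g) / to_fract (rat_den f * rat_den g)"
    by simp
  thus "f * g = to_fract (rat_num f * rat_num g) / to_fract (rat_den f * rat_den g)"
    by (simp only: rat_num_over_den)
  show "degree (rat_num f * rat_num g) \<le> degree (rat_den f * rat_den g)"
    using assms rat_den_nonzero[of f] rat_den_nonzero[of g] unfolding rat_proper_def
    by (intro order.trans[OF degree_mult_le]) (auto simp: degree_mult_eq)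
qed (simp add: rat_den_nonzero)

lemma rat_proper_0: "rat_proper 0"
  by (simp add: rat_proper_def rat_num_def rat_den_def)

lemma RH_inf_0: "0 \<in> RH_inf"
  by (simp add: RH_inf_def rat_proper_0 rat_poles_subset_ball_iff regular_simps)

lemma RH_inf_mult:
  assumes "G \<in> RH_inf" "H \<in> RH_inf"
  shows "G ** H \<in> RH_inf"
proof -
  have "rat_proper (\<Sum>k\<in>S. G $ i $ k * H $ k $ j)" for i j S
    using assms
    by (induction S rule: infinite_finite_induct)
      (simp_all add: RH_inf_def rat_proper_0 rat_proper_add rat_proper_mult)
  thus ?thesis
    using assms by (auto simp: RH_inf_def rat_poles_subset_ball_iff matrix_matrix_mult_def regular_simps)
qed

lemma RH_inf_circle_regular: "G \<in> RH_inf \<Longrightarrow> circle_regular G"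
  by (simp add: RH_inf_def rat_poles_subset_ball_iff circle_regular_def)

lemma matrix_inv_right_left: "invertible A \<Longrightarrow> A ** matrix_inv A = mat 1 \<and> matrix_inv A ** A = mat 1"
  by (simp add: invertible_def matrix_inv_def) (rule someI_ex)

lemma RH_inf_unitsD:
  assumes "G \<in> RH_inf_units"
  shows "G \<in> RH_inf" "matrix_inv G \<in> RH_inf" "circle_regular G" "circle_regular (matrix_inv G)"
    "G ** matrix_inv G = mat 1" "matrix_inv G ** G = mat 1"
  using assms by (auto simp: RH_inf_units_def RH_inf_circle_regular matrix_inv_right_left)

section \<open>Stable realizations and finite impulse responses\<close>

lemma regular_det:
  assumes "\<And>i j. regular complex_of_real z (M $ i $ j)"
  shows "regular complex_of_real z (det M)" "rat_subst complex_of_real z (det M) = det (tm_eval M z)"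
proof -
  have sgn: "regular complex_of_real z (of_int (sign p))"
    "rat_subst complex_of_real z (of_int (sign p)) = of_int (sign p)" for p :: "'a \<Rightarrow> 'a"
    by (simp_all add: sign_def regular_simps)
  show "regular complex_of_real z (det M)" "rat_subst complex_of_real z (det M) = det (tm_eval M z)"
    by (simp_all add: det_def regular_simps assms sgn tm_eval_def)
qed

text \<open>By Cramer's rule the entries of the resolvent are quotients of polynomials by \<open>det (z I - A)\<close>,
  which vanishes only at eigenvalues of \<open>A\<close>, that is, inside the disc.\<close>

lemma circle_regular_realization:
  fixes A :: "real^'n^'n"
  assumes "spectral_radius A < 1"
  shows "circle_regular (realization A B C D)"
proof -
  define P where "P = mat rat_z - const_tm A"
  have reg: "regular complex_of_real z (P $ i $ j)" for z i j
    by (simp add: P_def mat_def const_tm_def regular_simps)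
  have det_nz: "rat_subst complex_of_real z (det P) \<noteq> 0" if z: "cmod z = 1" for z
  proof
    assume "rat_subst complex_of_real z (det P) = 0"
    moreover have "tm_eval P z = mat z - map_matrix complex_of_real A"
      by (simp add: tm_eval_def P_def mat_def const_tm_def vec_eq_iff regular_simps)
    ultimately have "z \<in> eigenvalues (map_matrix complex_of_real A)"
      by (simp add: regular_det reg eigenvalues_iff_det)
    hence "cmod z \<le> spectral_radius A"
      unfolding spectral_radius_def by (intro Max_ge finite_imageI finite_eigenvalues imageI)
    with assms z show False by simp
  qed
  have "det P \<noteq> 0" using det_nz[of 1] by (auto simp: regular_simps)
  hence "invertible P" by (simp add: invertible_det_nz)
  hence inv: "P ** matrix_inv P = mat 1" by (simp add: matrix_inv_right_left)
  have "regular complex_of_real z (matrix_inv P $ k $ l)" if z: "cmod z = 1" for z k l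
  proof -
    have "P *v column l (matrix_inv P) = column l (mat 1)"
      by (simp add: inv[symmetric] column_def vec_eq_iff matrix_vector_mult_def matrix_matrix_mult_def)
    hence "column l (matrix_inv P) =
        (\<chi> k. det (\<chi> i j. if j = k then column l (mat 1) $ i else P $ i $ j) / det P)"
      using cramer[OF \<open>det P \<noteq> 0\<close>] by blast
    hence eq: "matrix_inv P $ k $ l =
        det (\<chi> i j. if j = k then column l (mat 1) $ i else P $ i $ j) / det P"
      by (simp add: column_def vec_eq_iff)
    show ?thesis unfolding eq
      by (intro regular_divide[OF real_hom_of_real] regular_det det_nz z)
        (auto simp: reg column_def mat_def regular_simps)
  qed
  hence "circle_regular (matrix_inv P)" by (simp add: circle_regular_def)
  thus ?thesis
    unfolding realization_def P_def[symmetric]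
    by (intro circle_regular_add circle_regular_mult circle_regular_const)
qed

lemma fir_space_circle_regular: "V \<in> fir_space N Ys \<Longrightarrow> circle_regular V"
  by (auto simp: fir_space_def intro!: circle_regular_sum circle_regular_scale_z circle_regular_const)

lemma fir_space_nonempty: 
  assumes "\<And>i. i < N \<Longrightarrow> subspace (Ys i)" shows "fir_space N Ys \<noteq> {}"
  using assms by (auto simp: fir_space_def subspace_0 intro!: exI[of _ "\<lambda>_. 0"])

section \<open>Algebra of transfer matrices\<close>

lemma matrix_add_rdistrib: "(A + B) ** C = A ** C + B ** C"
  for C :: "'a::semiring_1^'n^'m"
  by (simp add: matrix_matrix_mult_def vec_eq_iff distrib_right sum.distrib)

lemma matrix_diff_ldistrib: "A ** (B - C) = A ** B - A ** C"
  for A :: "'a::ring_1^'n^'m"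
  by (simp add: matrix_matrix_mult_def vec_eq_iff right_diff_distrib sum_subtractf)

lemma matrix_diff_rdistrib: "(A - B) ** C = A ** C - B ** C"
  for C :: "'a::ring_1^'n^'m"
  by (simp add: matrix_matrix_mult_def vec_eq_iff left_diff_distrib sum_subtractf)

lemma scale_tm_mult: "(c *\<^sub>t G) ** H = c *\<^sub>t (G ** H)" "G ** (c *\<^sub>t H) = c *\<^sub>t (G ** H)"
  by (simp_all add: scale_tm_def matrix_matrix_mult_def vec_eq_iff sum_distrib_left mult_ac)

lemma scale_tm_add: "c *\<^sub>t (G + H) = c *\<^sub>t G + c *\<^sub>t H" "c *\<^sub>t (G - H) = c *\<^sub>t G - c *\<^sub>t H"
  by (simp_all add: scale_tm_def vec_eq_iff algebra_simps)

lemma scale_tm_z_cancel: "rat_z ^ n *\<^sub>t inverse rat_z ^ n *\<^sub>t G = G"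
  by (simp add: scale_tm_def vec_eq_iff rat_z_nonzero power_inverse flip: mult.assoc)

section \<open>Spectral factors\<close>

lemma para_square_on_circle:
  assumes "circle_regular G" "cmod z = 1"
  shows "x \<bullet> (tm_eval (para_conj G ** G) z *v x) = (norm (tm_eval G z *v x))\<^sup>2"
  using assms by (simp add: tm_eval_mult circle_regular_para_conj tm_eval_para_conj norm_matrix_vector_sq)

text \<open>The identity between rational matrices is used only through its quadratic forms on the circle.\<close>

lemma pythagoras_on_circle:
  assumes "circle_regular M" "circle_regular Y" "circle_regular W"
    and "para_conj M ** M = para_conj Y ** Y + para_conj W ** W" "cmod z = 1"
  shows "(norm (tm_eval M z *v x))\<^sup>2 = (norm (tm_eval Y z *v x))\<^sup>2 + (norm (tm_eval W z *v x))\<^sup>2"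
  using arg_cong[OF assms(4), of "\<lambda>G. x \<bullet> (tm_eval G z *v x)"] assms(1-3,5)
  by (simp add: para_square_on_circle tm_eval_add circle_regular_mult circle_regular_para_conj
      matrix_vector_mult_add_rdistrib inner_add_right)

lemma hinf_norm_component_le:
  assumes "circle_regular M" "circle_regular Y" "circle_regular W"
    and "para_conj M ** M = para_conj Y ** Y + para_conj W ** W"
  shows "hinf_norm Y \<le> hinf_norm M"
proof -
  have "norm (tm_eval Y z *v x) \<le> hinf_norm M * norm x" if "cmod z = 1" for z x
  proof -
    have "(norm (tm_eval Y z *v x))\<^sup>2 \<le> (norm (tm_eval M z *v x))\<^sup>2"
      using pythagoras_on_circle[OF assms that, of x] by simp
    hence "norm (tm_eval Y z *v x) \<le> norm (tm_eval M z *v x)" by (rule power2_le_imp_le) simp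
    also have "\<dots> \<le> hinf_norm M * norm x" by (rule hinf_norm_bound[OF assms(1) that])
    finally show ?thesis .
  qed
  thus ?thesis by (simp add: hinf_norm_le_iff assms)
qed

text \<open>At a point of the circle the hypotheses say
  \<open>\<parallel>F x\<parallel>\<^sup>2 - \<parallel>W x\<parallel>\<^sup>2 = \<gamma>\<^sup>2 \<parallel>x\<parallel>\<^sup>2 - \<parallel>M x\<parallel>\<^sup>2\<close>.
  So \<open>M\<close> is bounded by \<open>\<gamma>\<close> exactly if \<open>W\<close> is dominated by \<open>F\<close>, which means that
  \<open>W F\<^sup>-\<^sup>1\<close> is a contraction (\<open>E\<close> is the inverse of \<open>F\<close>). The strict inequality
  needs a gap that is uniform on the circle; the bound on \<open>F\<close> provides it.\<close>

lemma spectral_factor_contraction: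
  assumes reg: "circle_regular M" "circle_regular Y" "circle_regular W" "circle_regular F" "circle_regular E"
    and sq: "para_conj M ** M = para_conj Y ** Y + para_conj W ** W"
    and fac: "para_conj F ** F = mat (rat_const (\<gamma>\<^sup>2)) - para_conj Y ** Y"
    and inv: "F ** E = mat 1" "E ** F = mat 1"
    and \<gamma>: "0 < \<gamma>"
  shows "hinf_norm (W ** E) \<le> 1 \<longleftrightarrow> hinf_norm M \<le> \<gamma>"
    and "hinf_norm M < \<gamma> \<Longrightarrow> hinf_norm (W ** E) < 1"
proof -
  have F: "(norm (tm_eval F z *v x))\<^sup>2 - (norm (tm_eval W z *v x))\<^sup>2 =
      \<gamma>\<^sup>2 * (norm x)\<^sup>2 - (norm (tm_eval M z *v x))\<^sup>2"
    if z: "cmod z = 1" for z x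
  proof -
    have "x \<bullet> (mat (complex_of_real (\<gamma>\<^sup>2)) *v x) = \<gamma>\<^sup>2 * (norm x)\<^sup>2"
      by (simp add: mat_mult_vec of_real_smult power2_norm_eq_inner del: of_real_power)
    moreover have "x \<bullet> (tm_eval (para_conj F ** F) z *v x) =
        x \<bullet> (tm_eval (mat (rat_const (\<gamma>\<^sup>2)) - para_conj Y ** Y) z *v x)"
      by (simp only: fac)
    ultimately have "(norm (tm_eval F z *v x))\<^sup>2 = \<gamma>\<^sup>2 * (norm x)\<^sup>2 - (norm (tm_eval Y z *v x))\<^sup>2"
      using reg z
      by (simp add: para_square_on_circle tm_eval_diff tm_eval_mat circle_regular_mat circle_regular_mult
          circle_regular_para_conj matrix_vector_mult_diff_rdistrib inner_diff_right del: of_real_power)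
    with pythagoras_on_circle[OF reg(1-3) sq z, of x] show ?thesis by simp
  qed
  have WE: "tm_eval (W ** E) z *v (tm_eval F z *v x) = tm_eval W z *v x"
    and EF: "tm_eval E z *v (tm_eval F z *v x) = x"
    and FE: "tm_eval F z *v (tm_eval E z *v u) = u" if z: "cmod z = 1" for z x u
  proof -
    have "tm_eval E z ** tm_eval F z = mat 1" "tm_eval F z ** tm_eval E z = mat 1"
      using arg_cong[OF inv(1), of "\<lambda>G. tm_eval G z"] arg_cong[OF inv(2), of "\<lambda>G. tm_eval G z"] reg z
      by (simp_all add: tm_eval_mult tm_eval_mat)
    thus "tm_eval (W ** E) z *v (tm_eval F z *v x) = tm_eval W z *v x"
      "tm_eval E z *v (tm_eval F z *v x) = x" "tm_eval F z *v (tm_eval E z *v u) = u"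
      using reg z by (simp_all add: tm_eval_mult matrix_vector_mul_assoc matrix_mul_assoc[symmetric])
  qed
  have regWE: "circle_regular (W ** E)" by (intro circle_regular_mult reg)
  have "hinf_norm (W ** E) \<le> 1 \<longleftrightarrow>
      (\<forall>z. cmod z = 1 \<longrightarrow> (\<forall>x. norm (tm_eval W z *v x) \<le> norm (tm_eval F z *v x)))"
    unfolding hinf_norm_le_iff[OF regWE] by (metis WE FE mult_1)
  also have "\<dots> \<longleftrightarrow> (\<forall>z. cmod z = 1 \<longrightarrow> (\<forall>x. norm (tm_eval M z *v x) \<le> \<gamma> * norm x))"
  proof -
    have "norm (tm_eval W z *v x) \<le> norm (tm_eval F z *v x) \<longleftrightarrow> norm (tm_eval M z *v x) \<le> \<gamma> * norm x"
      if z: "cmod z = 1" for z x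
    proof -
      have "norm (tm_eval W z *v x) \<le> norm (tm_eval F z *v x) \<longleftrightarrow>
          (norm (tm_eval W z *v x))\<^sup>2 \<le> (norm (tm_eval F z *v x))\<^sup>2"
        by (simp add: power_mono_iff)
      also have "\<dots> \<longleftrightarrow> (norm (tm_eval M z *v x))\<^sup>2 \<le> (\<gamma> * norm x)\<^sup>2"
        unfolding power_mult_distrib using F[OF z, of x] by linarith
      also have "\<dots> \<longleftrightarrow> norm (tm_eval M z *v x) \<le> \<gamma> * norm x"
        using \<gamma> by (simp add: power_mono_iff)
      finally show ?thesis .
    qed
    thus ?thesis by blast
  qed
  finally show "hinf_norm (W ** E) \<le> 1 \<longleftrightarrow> hinf_norm M \<le> \<gamma>"
    by (simp add: hinf_norm_le_iff reg)
  assume less: "hinf_norm M < \<gamma>"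
  define m where "m = hinf_norm M"
  \<comment> \<open>the summand 1 keeps \<open>k\<close> positive so that it can be divided by\<close>
  define k where "k = hinf_norm F + 1"
  have k: "k > 0" and m: "0 \<le> m"
    using hinf_norm_nonneg[OF reg(4)] hinf_norm_nonneg[OF reg(1)] by (simp_all add: k_def m_def)
  define c where "c = (\<gamma>\<^sup>2 - m\<^sup>2) / k\<^sup>2"
  have c: "c > 0" using less m k by (simp add: c_def m_def power_strict_mono)
  \<comment> \<open>the gap \<open>\<gamma>\<^sup>2 - m\<^sup>2\<close> in terms of \<open>x = F\<^sup>-\<^sup>1 u\<close> becomes a gap in terms of \<open>u\<close> by \<open>\<parallel>u\<parallel> \<le> k \<parallel>x\<parallel>\<close>\<close>
  have main: "(norm (tm_eval (W ** E) z *v u))\<^sup>2 \<le> (1 - c) * (norm u)\<^sup>2" if z: "cmod z = 1" for z u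
  proof -
    define x where "x = tm_eval E z *v u"
    have u: "u = tm_eval F z *v x" using FE[OF z] by (simp add: x_def)
    have "norm u \<le> k * norm x"
      unfolding u k_def using hinf_norm_bound[OF reg(4) z, of x] by (simp add: algebra_simps add_increasing)
    hence "(norm u)\<^sup>2 \<le> (k * norm x)\<^sup>2" by (intro power_mono) auto
    hence "c * (norm u)\<^sup>2 \<le> (\<gamma>\<^sup>2 - m\<^sup>2) * (norm x)\<^sup>2"
      using k c by (simp add: c_def power_mult_distrib divide_simps zero_less_divide_iff
          mult.commute mult.left_commute)
    moreover have "(norm (tm_eval M z *v x))\<^sup>2 \<le> m\<^sup>2 * (norm x)\<^sup>2"
      using power_mono[OF hinf_norm_bound[OF reg(1) z, of x], of 2] by (simp add: m_def power_mult_distrib)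
    ultimately show ?thesis
      using F[OF z, of x] WE[OF z, of x] by (simp add: u[symmetric] algebra_simps)
  qed
  have "norm (tm_eval (W ** E) z *v u) \<le> sqrt (1 - c) * norm u" if z: "cmod z = 1" for z u
    using real_sqrt_le_mono[OF main[OF z, of u]] by (simp add: real_sqrt_mult)
  hence "hinf_norm (W ** E) \<le> sqrt (1 - c)" by (simp add: hinf_norm_le_iff regWE)
  also have "\<dots> < 1" using c by simp
  finally show "hinf_norm (W ** E) < 1" .
qed

section \<open>Compressing an error by an inner factor\<close>

text \<open>The error is the sum of \<open>Y\<close>, its part orthogonal to the range of \<open>U\<close>, and \<open>U\<close> applied to the
  compressed error. The cross terms vanish because \<open>U\<^sup>\<sim> Y = 0\<close>, and \<open>U\<close> preserves squares.
  Only the compressed error depends on \<open>Q\<close>.\<close>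

lemma isometry_split:
  assumes "para_conj U ** U = mat 1"
    and "Y = (mat 1 - U ** para_conj U) ** T"
  shows "para_conj (T - U ** Q) ** (T - U ** Q) =
    para_conj Y ** Y + para_conj (para_conj U ** T - Q) ** (para_conj U ** T - Q)"
proof -
  define W where "W = para_conj U ** T - Q"
  have M: "T - U ** Q = Y + U ** W"
    by (simp add: assms(2) W_def matrix_diff_ldistrib matrix_diff_rdistrib matrix_mul_assoc)
  have "para_conj U ** Y = (para_conj U - (para_conj U ** U) ** para_conj U) ** T"
    by (simp add: assms(2) matrix_diff_ldistrib matrix_diff_rdistrib matrix_mul_assoc)
  hence UY: "para_conj U ** Y = 0" by (simp add: assms(1))
  hence YU: "para_conj Y ** U = 0"
    by (metis para_conj_mult para_conj_para_conj para_conj_diff diff_self)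
  have "para_conj (Y + U ** W) ** (Y + U ** W) =
      para_conj Y ** Y + (para_conj Y ** U) ** W + para_conj W ** (para_conj U ** Y) +
      para_conj W ** (para_conj U ** U) ** W"
    by (simp add: para_conj_add para_conj_mult matrix_add_ldistrib matrix_add_rdistrib matrix_mul_assoc)
  also have "\<dots> = para_conj Y ** Y + para_conj W ** W"
    by (simp add: YU UY assms(1))
  finally show ?thesis by (simp only: M W_def)
qed


lemmas circle_regular_intros = circle_regular_add circle_regular_diff circle_regular_mult
  circle_regular_mat_1 circle_regular_para_conj circle_regular_scale_z

text \<open>A left inner factor \<open>U\<close> is removed from a model-matching error. The unreachable part \<open>Y\<close> is a lower
  bound for the error; above this bound, a spectral factor of \<open>\<gamma>\<^sup>2 I - Y\<^sup>\<sim> Y\<close> absorbs \<open>Y\<close> and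
  rescales the remaining problem to the level 1.\<close>

lemma isometry_reduction:
  assumes reg: "circle_regular U" "circle_regular T" "circle_regular Q"
    and iso: "para_conj U ** U = mat 1"
    and Y: "Y = (mat 1 - U ** para_conj U) ** T"
  shows "hinf_norm Y \<le> hinf_norm (T - U ** Q)"
    and "\<lbrakk>circle_regular F; circle_regular E; F ** E = mat 1; E ** F = mat 1; 0 < \<gamma>;
          para_conj F ** F = mat (rat_const (\<gamma>\<^sup>2)) - para_conj Y ** Y\<rbrakk> \<Longrightarrow>
         hinf_norm ((para_conj U ** T - Q) ** E) \<le> 1 \<longleftrightarrow> hinf_norm (T - U ** Q) \<le> \<gamma>"
    and "\<lbrakk>circle_regular F; circle_regular E; F ** E = mat 1; E ** F = mat 1; 0 < \<gamma>;
          para_conj F ** F = mat (rat_const (\<gamma>\<^sup>2)) - para_conj Y ** Y;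
          hinf_norm (T - U ** Q) < \<gamma>\<rbrakk> \<Longrightarrow> hinf_norm ((para_conj U ** T - Q) ** E) < 1"
proof -
  have regs: "circle_regular (T - U ** Q)" "circle_regular Y" "circle_regular (para_conj U ** T - Q)"
    unfolding Y by (simp_all add: circle_regular_intros reg)
  note split = isometry_split[OF iso Y]
  show "hinf_norm Y \<le> hinf_norm (T - U ** Q)"
    by (rule hinf_norm_component_le[OF regs split])
  show "\<lbrakk>circle_regular F; circle_regular E; F ** E = mat 1; E ** F = mat 1; 0 < \<gamma>;
          para_conj F ** F = mat (rat_const (\<gamma>\<^sup>2)) - para_conj Y ** Y\<rbrakk> \<Longrightarrow>
         hinf_norm ((para_conj U ** T - Q) ** E) \<le> 1 \<longleftrightarrow> hinf_norm (T - U ** Q) \<le> \<gamma>"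
    by (rule spectral_factor_contraction(1)[OF regs _ _ split])
  show "\<lbrakk>circle_regular F; circle_regular E; F ** E = mat 1; E ** F = mat 1; 0 < \<gamma>;
          para_conj F ** F = mat (rat_const (\<gamma>\<^sup>2)) - para_conj Y ** Y;
          hinf_norm (T - U ** Q) < \<gamma>\<rbrakk> \<Longrightarrow> hinf_norm ((para_conj U ** T - Q) ** E) < 1"
    by (rule spectral_factor_contraction(2)[OF regs _ _ split])
qed

lemma rat_const_1: "rat_const 1 = 1"
  using real_hom_rat_const unfolding real_hom_def by blast

text \<open>The mirror image for a right co-inner factor, obtained by conjugating everything; conjugation
  reverses products and preserves the norm.\<close>

lemma co_isometry_reduction:
  assumes reg: "circle_regular V" "circle_regular T" "circle_regular Q"
    and iso: "V ** para_conj V = mat 1"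
    and Z: "Z = T ** (mat 1 - para_conj V ** V)"
  shows "hinf_norm Z \<le> hinf_norm (T - Q ** V)"
    and "\<lbrakk>circle_regular F; circle_regular E; F ** E = mat 1; E ** F = mat 1;
          F ** para_conj F = mat 1 - Z ** para_conj Z\<rbrakk> \<Longrightarrow>
         hinf_norm (E ** (T ** para_conj V - Q)) \<le> 1 \<longleftrightarrow> hinf_norm (T - Q ** V) \<le> 1"
    and "\<lbrakk>circle_regular F; circle_regular E; F ** E = mat 1; E ** F = mat 1;
          F ** para_conj F = mat 1 - Z ** para_conj Z; hinf_norm (T - Q ** V) < 1\<rbrakk> \<Longrightarrow>
         hinf_norm (E ** (T ** para_conj V - Q)) < 1"
proof -
  have regZ: "circle_regular Z" unfolding Z by (simp add: circle_regular_intros reg)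
  have iso': "para_conj (para_conj V) ** para_conj V = mat 1" by (simp add: para_conj_para_conj iso)
  have Y': "para_conj Z = (mat 1 - para_conj V ** para_conj (para_conj V)) ** para_conj T"
    by (simp add: Z para_conj_mult para_conj_diff para_conj_mat_1 para_conj_para_conj)
  note red = isometry_reduction[OF circle_regular_para_conj[OF reg(1)]
      circle_regular_para_conj[OF reg(2)] circle_regular_para_conj[OF reg(3)] iso' Y']
  have M: "hinf_norm (para_conj T - para_conj V ** para_conj Q) = hinf_norm (T - Q ** V)"
    using hinf_norm_para_conj[of "T - Q ** V"]
    by (simp add: circle_regular_intros reg para_conj_diff para_conj_mult)
  show "hinf_norm Z \<le> hinf_norm (T - Q ** V)"
    using red(1) by (simp add: M hinf_norm_para_conj regZ)
  {
    assume E: "circle_regular F" "circle_regular E" "F ** E = mat 1" "E ** F = mat 1"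
      and fac: "F ** para_conj F = mat 1 - Z ** para_conj Z"
    have P: "hinf_norm ((para_conj (para_conj V) ** para_conj T - para_conj Q) ** para_conj E) =
        hinf_norm (E ** (T ** para_conj V - Q))"
      using hinf_norm_para_conj[of "E ** (T ** para_conj V - Q)"]
      by (simp add: circle_regular_intros reg E(1,2) para_conj_diff para_conj_mult)
    have inv: "para_conj F ** para_conj E = mat 1" "para_conj E ** para_conj F = mat 1"
      using E(3,4) by (simp_all add: para_conj_mat_1 flip: para_conj_mult)
    have fac': "para_conj (para_conj F) ** para_conj F =
        mat (rat_const (1\<^sup>2)) - para_conj (para_conj Z) ** para_conj Z"
      by (simp add: para_conj_para_conj fac rat_const_1)
    note prems = circle_regular_para_conj[OF E(1)] circle_regular_para_conj[OF E(2)] inv zero_less_one fac'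
    show "hinf_norm (E ** (T ** para_conj V - Q)) \<le> 1 \<longleftrightarrow> hinf_norm (T - Q ** V) \<le> 1"
      using red(2)[OF prems] by (simp only: M P)
    assume "hinf_norm (T - Q ** V) < 1"
    thus "hinf_norm (E ** (T ** para_conj V - Q)) < 1"
      using red(3)[OF prems] by (simp only: M P)
  }
qed

section \<open>The model-matching problem\<close>

theorem theorem4:
  fixes A :: "real^'n^'n"
    and B1 :: "real^'q1^'n" and B2 :: "real^'p2^'n"
    and C1 :: "real^'n^'p1" and C2 :: "real^'n^'q2"
    and D12 :: "real^'p2^'p1" and D21 :: "real^'q1^'q2"
    and T1 :: "('p1, 'q1) transfer" and T2 :: "('p1, 'p2) transfer" and T3 :: "('q2, 'q1) transfer"
    and Ui :: "('p1, 'p2) transfer" and Uo :: "('p2, 'p2) transfer"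
    and Y :: "('p1, 'q1) transfer"
    and Yo :: "real \<Rightarrow> ('q1, 'q1) transfer"
    and Vco :: "real \<Rightarrow> ('q2, 'q2) transfer" and Vci :: "real \<Rightarrow> ('q2, 'q1) transfer"
    and Z :: "real \<Rightarrow> ('p2, 'q1) transfer"
    and Zco :: "real \<Rightarrow> ('p2, 'p2) transfer"
    and R :: "real \<Rightarrow> ('p2, 'q2) transfer"
    and Rhat :: "real \<Rightarrow> ('p2, 'q2) transfer \<Rightarrow> ('p2, 'q2) transfer"
    and N :: nat
    and Ys :: "nat \<Rightarrow> (real^'q2^'p2) set"
    and YY :: "('p2, 'q2) transfer set"
    and T1hat :: "('p2, 'q2) transfer \<Rightarrow> ('p1, 'q1) transfer"
    and T2hat :: "('p1, 'p2) transfer"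
    and \<alpha> :: real
  assumes "spectral_radius A < 1"
    and "pos_def_mat (transpose D12 ** D12)" and "pos_def_mat (D21 ** transpose D21)"
    and "transpose C1 ** D12 = 0" and "B1 ** transpose D21 = 0"
    and "T1 = realization A B1 C1 0"
    and "T2 = realization A B2 C1 D12"
    and "T3 = realization A B1 C2 D21"
    and "T2 = Ui ** Uo" and "Ui \<in> RH_inf" and "Uo \<in> RH_inf_units"
    and "para_conj Ui ** Ui = mat 1"
    and "Y = (mat 1 - Ui ** para_conj Ui) ** T1"
    and "\<And>\<gamma>. hinf_norm Y < \<gamma> \<Longrightarrow> Yo \<gamma> \<in> RH_inf_units"
    and "\<And>\<gamma>. hinf_norm Y < \<gamma> \<Longrightarrow>
           para_conj (Yo \<gamma>) ** Yo \<gamma> = mat (rat_const (\<gamma>\<^sup>2)) - para_conj Y ** Y"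
    and "\<And>\<gamma>. hinf_norm Y < \<gamma> \<Longrightarrow> T3 ** matrix_inv (Yo \<gamma>) = Vco \<gamma> ** Vci \<gamma>"
    and "\<And>\<gamma>. hinf_norm Y < \<gamma> \<Longrightarrow> Vci \<gamma> \<in> RH_inf"
    and "\<And>\<gamma>. hinf_norm Y < \<gamma> \<Longrightarrow> Vco \<gamma> \<in> RH_inf_units"
    and "\<And>\<gamma>. hinf_norm Y < \<gamma> \<Longrightarrow> Vci \<gamma> ** para_conj (Vci \<gamma>) = mat 1"
    and "\<And>\<gamma>. hinf_norm Y < \<gamma> \<Longrightarrow>
           Z \<gamma> = para_conj Ui ** T1 ** matrix_inv (Yo \<gamma>) **
                   (mat 1 - para_conj (Vci \<gamma>) ** Vci \<gamma>)"
    and "\<And>\<gamma>. hinf_norm Y < \<gamma> \<Longrightarrow> hinf_norm (Z \<gamma>) < 1 \<Longrightarrow> Zco \<gamma> \<in> RH_inf_units"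
    and "\<And>\<gamma>. hinf_norm Y < \<gamma> \<Longrightarrow> hinf_norm (Z \<gamma>) < 1 \<Longrightarrow>
           Zco \<gamma> ** para_conj (Zco \<gamma>) = mat 1 - Z \<gamma> ** para_conj (Z \<gamma>)"
    and "\<And>\<gamma>. hinf_norm Y < \<gamma> \<Longrightarrow> hinf_norm (Z \<gamma>) < 1 \<Longrightarrow>
           R \<gamma> = matrix_inv (Zco \<gamma>) ** para_conj Ui ** T1 ** matrix_inv (Yo \<gamma>) **
                   para_conj (Vci \<gamma>)"
    and "1 \<le> N"
    and "\<And>i. i < N \<Longrightarrow> subspace (Ys i)"
    and "YY = fir_space N Ys"
    and "\<And>\<gamma> V. hinf_norm Y < \<gamma> \<Longrightarrow> hinf_norm (Z \<gamma>) < 1 \<Longrightarrow> V \<in> YY \<Longrightarrow>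
           Rhat \<gamma> V = rat_z ^ N *\<^sub>t R \<gamma> -
             matrix_inv (Zco \<gamma>) ** Uo ** (rat_z ^ N *\<^sub>t V) ** Vco \<gamma>"
    and "\<And>V. T1hat V = T1 - T2 ** V ** T3"
    and "T2hat = inverse rat_z ^ N *\<^sub>t T2"
    and "\<alpha> = Inf {hinf_norm (T1hat V - T2hat ** D ** T3) | D V. D \<in> RH_inf \<and> V \<in> YY}"
  shows "\<alpha> = Inf {\<gamma>. hinf_norm Y < \<gamma> \<and> hinf_norm (Z \<gamma>) < 1 \<and>
                     (\<exists>V\<in>YY. dist_RH_inf (Rhat \<gamma> V) < 1)} \<and>
         (\<forall>\<gamma>>\<alpha>. \<forall>V\<in>YY. \<forall>D\<in>RH_inf. \<forall>X\<in>RH_inf.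
           hinf_norm (Rhat \<gamma> V - X) \<le> 1 \<and> X = matrix_inv (Zco \<gamma>) ** Uo ** D ** Vco \<gamma> \<longrightarrow>
           hinf_norm (T1hat V - T2hat ** D ** T3) \<le> \<gamma>)"
proof -
  note spec = assms(1) and T1 = assms(6) and T3 = assms(8) and fac2 = assms(9)
    and Ui = assms(10) and Uo = assms(11) and Ui_iso = assms(12) and Y = assms(13)
    and Yo = assms(14) and Yo_fac = assms(15) and T3_fac = assms(16)
    and Vci = assms(17) and Vco = assms(18) and Vci_iso = assms(19) and Z = assms(20)
    and Zco = assms(21) and Zco_fac = assms(22) and R = assms(23)
    and sub = assms(25) and YY = assms(26) and Rhat = assms(27) and T1hat = assms(28)
    and T2hat = assms(29) and \<alpha> = assms(30)
  have regT1: "circle_regular T1" and regT3: "circle_regular T3"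
    unfolding T1 T3 by (rule circle_regular_realization[OF spec])+
  have regUi: "circle_regular Ui" by (rule RH_inf_circle_regular[OF Ui])
  note regUo = RH_inf_unitsD(3)[OF Uo]
  have regY: "circle_regular Y"
    unfolding Y by (simp add: circle_regular_intros regUi regT1)
  have regV: "circle_regular V" if "V \<in> YY" for V
    using that unfolding YY by (rule fir_space_circle_regular)
  \<comment> \<open>the delayed free part and the structured part of the controller parameter together\<close>
  define Q :: "('p2, 'q2) transfer \<Rightarrow> ('p2, 'q2) transfer \<Rightarrow> ('p2, 'q2) transfer"
    where "Q D V = V + inverse rat_z ^ N *\<^sub>t D" for D V
  have regQ: "circle_regular (Q D V)" if "D \<in> RH_inf" "V \<in> YY" for D V
    unfolding Q_def by (simp add: circle_regular_intros RH_inf_circle_regular regV that)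
  define M where "M D V = T1hat V - T2hat ** D ** T3" for D V
  have M: "M D V = T1 - Ui ** (Uo ** Q D V ** T3)" for D V
    by (simp add: M_def T1hat T2hat fac2 Q_def scale_tm_mult matrix_add_ldistrib
        matrix_add_rdistrib matrix_mul_assoc algebra_simps)
  have regM: "circle_regular (M D V)" if "D \<in> RH_inf" "V \<in> YY" for D V
    unfolding M by (simp add: circle_regular_intros regT1 regUi regUo regQ regT3 that)
  have Y_le: "hinf_norm Y \<le> hinf_norm (M D V)" if "D \<in> RH_inf" "V \<in> YY" for D V
    unfolding M
    by (rule isometry_reduction(1)[OF regUi regT1 _ Ui_iso Y])
      (simp add: circle_regular_intros regUo regQ regT3 that)
  \<comment> \<open>the error after the removal of \<open>U\<^sub>i\<close> and division by \<open>Y\<^sub>o\<close>\<close>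
  define S where "S \<gamma> D V = (para_conj Ui ** T1 - Uo ** Q D V ** T3) ** matrix_inv (Yo \<gamma>)" for \<gamma> D V
  define L where "L \<gamma> = para_conj Ui ** T1 ** matrix_inv (Yo \<gamma>)" for \<gamma>
  have S: "S \<gamma> D V = L \<gamma> - (Uo ** Q D V ** Vco \<gamma>) ** Vci \<gamma>" if "hinf_norm Y < \<gamma>" for \<gamma> D V
  proof -
    have "Uo ** Q D V ** T3 ** matrix_inv (Yo \<gamma>) = Uo ** Q D V ** (Vco \<gamma> ** Vci \<gamma>)"
      by (simp add: T3_fac[OF that] matrix_mul_assoc[symmetric])
    thus ?thesis by (simp add: S_def L_def matrix_diff_rdistrib matrix_mul_assoc)
  qed
  have S_le: "hinf_norm (S \<gamma> D V) \<le> 1 \<longleftrightarrow> hinf_norm (M D V) \<le> \<gamma>"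
    and S_less: "hinf_norm (M D V) < \<gamma> \<Longrightarrow> hinf_norm (S \<gamma> D V) < 1"
    if \<gamma>: "hinf_norm Y < \<gamma>" and DV: "D \<in> RH_inf" "V \<in> YY" for \<gamma> D V
  proof -
    note Yo_inv = RH_inf_unitsD(3-6)[OF Yo[OF \<gamma>]]
    have "0 < \<gamma>" using hinf_norm_nonneg[OF regY] \<gamma> by simp
    moreover have "circle_regular (Uo ** Q D V ** T3)"
      by (simp add: circle_regular_intros regUo regQ regT3 DV)
    ultimately show "hinf_norm (S \<gamma> D V) \<le> 1 \<longleftrightarrow> hinf_norm (M D V) \<le> \<gamma>"
      "hinf_norm (M D V) < \<gamma> \<Longrightarrow> hinf_norm (S \<gamma> D V) < 1"
      unfolding M S_def
      using isometry_reduction(2,3)[OF regUi regT1 _ Ui_iso Y Yo_inv _ Yo_fac[OF \<gamma>]] by blast+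
  qed
  have Z_L: "Z \<gamma> = L \<gamma> ** (mat 1 - para_conj (Vci \<gamma>) ** Vci \<gamma>)" if "hinf_norm Y < \<gamma>" for \<gamma>
    by (simp add: Z[OF that] L_def)
  have regL: "circle_regular (L \<gamma>)" and regVci: "circle_regular (Vci \<gamma>)"
    and regVco: "circle_regular (Vco \<gamma>)" if "hinf_norm Y < \<gamma>" for \<gamma>
    using RH_inf_unitsD[OF Yo[OF that]] RH_inf_unitsD[OF Vco[OF that]]
      RH_inf_circle_regular[OF Vci[OF that]]
    by (simp_all add: L_def circle_regular_intros regUi regT1)
  have regP: "circle_regular (Uo ** Q D V ** Vco \<gamma>)"
    if "hinf_norm Y < \<gamma>" "D \<in> RH_inf" "V \<in> YY" for \<gamma> D V
    by (simp add: circle_regular_intros regUo regQ regVco that)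
  have Z_less: "hinf_norm (Z \<gamma>) < 1"
    if \<gamma>: "hinf_norm Y < \<gamma>" and DV: "D \<in> RH_inf" "V \<in> YY" and "hinf_norm (M D V) < \<gamma>"
    for \<gamma> D V
    using co_isometry_reduction(1)[OF regVci[OF \<gamma>] regL[OF \<gamma>] regP[OF \<gamma> DV] Vci_iso[OF \<gamma>] Z_L[OF \<gamma>]]
      S_less[OF that] S[OF \<gamma>] by simp
  have regRhat: "circle_regular (Rhat \<gamma> V)"
    if \<gamma>: "hinf_norm Y < \<gamma>" "hinf_norm (Z \<gamma>) < 1" and V: "V \<in> YY" for \<gamma> V
    unfolding Rhat[OF \<gamma> V] R[OF \<gamma>]
    by (simp add: circle_regular_intros regV V regUo regUi regT1 regVco regVci \<gamma>(1)
        RH_inf_unitsD[OF Yo[OF \<gamma>(1)]] RH_inf_unitsD[OF Zco[OF \<gamma>]])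
  have Rhat_le: "hinf_norm (Rhat \<gamma> V - matrix_inv (Zco \<gamma>) ** Uo ** D ** Vco \<gamma>) \<le> 1 \<longleftrightarrow>
        hinf_norm (M D V) \<le> \<gamma>"
    and Rhat_less: "hinf_norm (M D V) < \<gamma> \<Longrightarrow>
        hinf_norm (Rhat \<gamma> V - matrix_inv (Zco \<gamma>) ** Uo ** D ** Vco \<gamma>) < 1"
    if \<gamma>: "hinf_norm Y < \<gamma>" "hinf_norm (Z \<gamma>) < 1" and DV: "D \<in> RH_inf" "V \<in> YY" for \<gamma> D V
  proof -
    note Zco_inv = RH_inf_unitsD(3-6)[OF Zco[OF \<gamma>]]
    let ?P = "matrix_inv (Zco \<gamma>) ** (L \<gamma> ** para_conj (Vci \<gamma>) - Uo ** Q D V ** Vco \<gamma>)"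
    \<comment> \<open>\<open>z\<^sup>N\<close> turns \<open>Q D V\<close> into \<open>z\<^sup>N V + D\<close>\<close>
    have "Rhat \<gamma> V - matrix_inv (Zco \<gamma>) ** Uo ** D ** Vco \<gamma> = rat_z ^ N *\<^sub>t ?P"
    proof -
      have "rat_z ^ N *\<^sub>t (Uo ** Q D V ** Vco \<gamma>) = Uo ** (rat_z ^ N *\<^sub>t Q D V) ** Vco \<gamma>"
        by (simp add: scale_tm_mult)
      also have "rat_z ^ N *\<^sub>t Q D V = rat_z ^ N *\<^sub>t V + D"
        by (simp add: Q_def scale_tm_add scale_tm_z_cancel)
      finally have 1: "rat_z ^ N *\<^sub>t (Uo ** Q D V ** Vco \<gamma>) = Uo ** (rat_z ^ N *\<^sub>t V + D) ** Vco \<gamma>" .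
      have "rat_z ^ N *\<^sub>t ?P = matrix_inv (Zco \<gamma>) **
          (rat_z ^ N *\<^sub>t (L \<gamma> ** para_conj (Vci \<gamma>)) - rat_z ^ N *\<^sub>t (Uo ** Q D V ** Vco \<gamma>))"
        by (simp only: scale_tm_mult(2)[symmetric] scale_tm_add)
      also have "\<dots> = rat_z ^ N *\<^sub>t R \<gamma> - matrix_inv (Zco \<gamma>) ** Uo ** (rat_z ^ N *\<^sub>t V + D) ** Vco \<gamma>"
        unfolding 1 by (simp add: R[OF \<gamma>] L_def matrix_diff_ldistrib scale_tm_mult matrix_mul_assoc)
      finally show ?thesis
        by (simp add: Rhat[OF \<gamma> DV(2)] matrix_add_ldistrib matrix_add_rdistrib)
    qed
    moreover have "circle_regular ?P"
      by (simp add: circle_regular_intros Zco_inv regL[OF \<gamma>(1)] regVci[OF \<gamma>(1)] regP[OF \<gamma>(1) DV])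
    ultimately have norm: "hinf_norm (Rhat \<gamma> V - matrix_inv (Zco \<gamma>) ** Uo ** D ** Vco \<gamma>) = hinf_norm ?P"
      by (simp add: hinf_norm_scale_z)
    note red = co_isometry_reduction(2,3)[OF regVci[OF \<gamma>(1)] regL[OF \<gamma>(1)] regP[OF \<gamma>(1) DV]
        Vci_iso[OF \<gamma>(1)] Z_L[OF \<gamma>(1)] Zco_inv Zco_fac[OF \<gamma>]]
    show "hinf_norm (Rhat \<gamma> V - matrix_inv (Zco \<gamma>) ** Uo ** D ** Vco \<gamma>) \<le> 1 \<longleftrightarrow>
        hinf_norm (M D V) \<le> \<gamma>"
      unfolding norm red(1) using S_le[OF \<gamma>(1) DV] S[OF \<gamma>(1)] by simp
    assume "hinf_norm (M D V) < \<gamma>"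
    with S_less[OF \<gamma>(1) DV] S[OF \<gamma>(1)] red(2)
    show "hinf_norm (Rhat \<gamma> V - matrix_inv (Zco \<gamma>) ** Uo ** D ** Vco \<gamma>) < 1"
      unfolding norm by simp
  qed
  \<comment> \<open>the distance is the infimum of a nonempty set of nonnegative numbers\<close>
  have dist_less: "dist_RH_inf (Rhat \<gamma> V) < 1 \<longleftrightarrow> (\<exists>X\<in>RH_inf. hinf_norm (Rhat \<gamma> V - X) < 1)"
    if "hinf_norm Y < \<gamma>" "hinf_norm (Z \<gamma>) < 1" "V \<in> YY" for \<gamma> V
    unfolding dist_RH_inf_def
  proof (rule cINF_less_iff)
    show "RH_inf \<noteq> ({} :: ('p2, 'q2) transfer set)" using RH_inf_0 by blast
    show "bdd_below ((\<lambda>X. hinf_norm (Rhat \<gamma> V - X)) ` RH_inf)"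
      by (rule bdd_belowI2[of _ 0])
        (simp add: hinf_norm_nonneg circle_regular_intros regRhat that RH_inf_circle_regular)
  qed
  define achieved where "achieved = {hinf_norm (M D V) | D V. D \<in> RH_inf \<and> V \<in> YY}"
  have \<alpha>: "\<alpha> = Inf achieved" unfolding achieved_def M_def by (rule \<alpha>)
  have achieved_bdd: "bdd_below achieved"
    unfolding achieved_def by (rule bdd_belowI[of _ 0]) (auto simp: hinf_norm_nonneg regM)
  have achieved_ne: "achieved \<noteq> {}"
  proof -
    have "YY \<noteq> {}" unfolding YY by (rule fir_space_nonempty) (rule sub)
    then obtain V where "V \<in> YY" by auto
    hence "hinf_norm (M 0 V) \<in> achieved" unfolding achieved_def using RH_inf_0 by auto
    thus ?thesis by auto
  qed
  define feasible where "feasible = {\<gamma>. hinf_norm Y < \<gamma> \<and> hinf_norm (Z \<gamma>) < 1 \<and>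
                     (\<exists>V\<in>YY. dist_RH_inf (Rhat \<gamma> V) < 1)}"
  have above: "hinf_norm Y < \<gamma>" "hinf_norm (Z \<gamma>) < 1" "\<gamma> \<in> feasible" if "\<alpha> < \<gamma>" for \<gamma>
  proof -
    from that obtain D V where DV: "D \<in> RH_inf" "V \<in> YY" and less: "hinf_norm (M D V) < \<gamma>"
      unfolding \<alpha> cInf_less_iff[OF achieved_ne achieved_bdd] by (auto simp: achieved_def)
    show \<gamma>: "hinf_norm Y < \<gamma>" using Y_le[OF DV] less by simp
    show Z\<gamma>: "hinf_norm (Z \<gamma>) < 1" by (rule Z_less[OF \<gamma> DV less])
    have "matrix_inv (Zco \<gamma>) ** Uo ** D ** Vco \<gamma> \<in> RH_inf"
      using RH_inf_unitsD[OF Zco[OF \<gamma> Z\<gamma>]] RH_inf_unitsD[OF Uo] RH_inf_unitsD[OF Vco[OF \<gamma>]] DV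
      by (simp add: RH_inf_mult)
    with Rhat_less[OF \<gamma> Z\<gamma> DV less] have "dist_RH_inf (Rhat \<gamma> V) < 1"
      using dist_less[OF \<gamma> Z\<gamma> DV(2)] by blast
    with \<gamma> Z\<gamma> DV(2) show "\<gamma> \<in> feasible" by (auto simp: feasible_def)
  qed
  have below: "\<alpha> \<le> \<gamma>" if "\<gamma> \<in> feasible" for \<gamma>
  proof -
    from that obtain V where \<gamma>: "hinf_norm Y < \<gamma>" "hinf_norm (Z \<gamma>) < 1" and V: "V \<in> YY"
      and "dist_RH_inf (Rhat \<gamma> V) < 1" by (auto simp: feasible_def)
    with dist_less obtain X where X: "X \<in> RH_inf" "hinf_norm (Rhat \<gamma> V - X) < 1" by blast
    note uo = RH_inf_unitsD[OF Uo] and zco = RH_inf_unitsD[OF Zco[OF \<gamma>]]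
      and vco = RH_inf_unitsD[OF Vco[OF \<gamma>(1)]]
    \<comment> \<open>\<open>U\<^sub>o\<close>, \<open>V\<^sub>c\<^sub>o\<close> and \<open>Z\<^sub>c\<^sub>o\<close> are units, so every proper stable \<open>X\<close> has the form required in the second claim\<close>
    define D where "D = matrix_inv Uo ** Zco \<gamma> ** X ** matrix_inv (Vco \<gamma>)"
    have D: "D \<in> RH_inf" unfolding D_def by (simp add: RH_inf_mult uo zco vco X)
    have "matrix_inv (Zco \<gamma>) ** Uo ** D ** Vco \<gamma> =
        matrix_inv (Zco \<gamma>) ** (Uo ** matrix_inv Uo) ** Zco \<gamma> ** X ** (matrix_inv (Vco \<gamma>) ** Vco \<gamma>)"
      by (simp only: D_def matrix_mul_assoc)
    also have "\<dots> = X" by (simp add: uo zco vco)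
    finally have "hinf_norm (M D V) \<le> \<gamma>"
      using Rhat_le[OF \<gamma> D V] X(2) by simp
    moreover have "\<alpha> \<le> hinf_norm (M D V)"
      unfolding \<alpha> using D V achieved_bdd by (intro cInf_lower) (auto simp: achieved_def)
    ultimately show ?thesis by simp
  qed
  have "Inf feasible = \<alpha>"
  proof (rule antisym)
    have "bdd_below feasible" using below by (rule bdd_belowI)
    hence "Inf feasible \<le> \<gamma>" if "\<alpha> < \<gamma>" for \<gamma>
      using above(3)[OF that] by (intro cInf_lower)
    thus "Inf feasible \<le> \<alpha>" by (rule dense_ge)
    show "\<alpha> \<le> Inf feasible"
      using above(3)[of "\<alpha> + 1"] below by (intro cInf_greatest) auto
  qed
  moreover have "hinf_norm (M D V) \<le> \<gamma>"
    if "\<alpha> < \<gamma>" "V \<in> YY" "D \<in> RH_inf"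
      "hinf_norm (Rhat \<gamma> V - matrix_inv (Zco \<gamma>) ** Uo ** D ** Vco \<gamma>) \<le> 1" for \<gamma> D V
    using Rhat_le[OF above(1,2)[OF that(1)] that(3,2)] that(4) by simp
  ultimately show ?thesis by (auto simp: feasible_def M_def)
qed

end
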